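(* There is a constant $C_n>0$ depending only on $n$ such that the following holds. Let $\Omega\subset\mathbb H^n$ be an open, horizontally bounded and (Euclidean) convex set. If $u:\overline\Omega\to\mathbb R$ is a continuous $H$-convex function with $u=0$ on $\partial\Omega$, then $$|u(\xi_0)|^{2n}\le C_n\,\mathrm{dist}_H(\xi_0,\partial\Omega)\,\mathrm{diam}_{HS}(\Omega)^{2n-1}\,\mathcal L^{2n}_{HS}(\partial_Hu(\Omega))\qquad\forall\xi_0\in\Omega.$$
   Context: $\mathbb H^n=\mathbb C^n\times\mathbb R\cong\mathbb R^{2n+1}$ with real coordinates $(x,y,t)$, $z=x+iy$, group law $(z,t)\circ(z',t')=(z+z',t+t'+2\,\mathrm{Im}\langle z,z'\rangle)$, $\langle z,z'\rangle=\sum_j z_j\overline{z'_j}$. Dilations $\delta_\lambda(z,t)=(\lambda z,\lambda^2t)$. Horizontal plane at $\xi_0=(x_0,y_0,t_0)$: $H_{\xi_0}=\{(x,y,t):t=t_0+2(x\cdot y_0-x_0\cdot y)\}$. $\mathrm{Pr}_1(x,y,t)=(x,y)$. Gauge $N(z,t)=(|z|^4+t^2)^{1/4}$, metric $d_H(\xi,\zeta)=N(\zeta^{-1}\circ\xi)$, $\mathrm{dist}_H(\xi,A)=\inf_{\zeta\in A}d_H(\xi,\zeta)$, $\mathrm{diam}_H$ the $d_H$-diameter. A set $\tilde\Omega$ is $H$-convex if for all $\xi_1,\xi_2\in\tilde\Omega$ with $\xi_1\in H_{\xi_2}$ and $\lambda\in[0,1]$, $\xi_1\circ\delta_\lambda(\xi_1^{-1}\circ\xi_2)\in\tilde\Omega$;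 a function $u$ on $\tilde\Omega$ is $H$-convex if $u(\xi_1\circ\delta_\lambda(\xi_1^{-1}\circ\xi_2))\le(1-\lambda)u(\xi_1)+\lambda u(\xi_2)$ for all such $\xi_1,\xi_2,\lambda$. Horizontal slicing diameter: $\mathrm{diam}_{HS}(\Omega)=\sup\{\mathrm{diam}_H(\Omega\cap H_\xi):\xi\in\Omega\}$; $\Omega$ is horizontally bounded if this is finite. For $\xi_0\in\Omega$, $\partial_Hu(\xi_0)=\{p\in\mathbb R^{2n}:u(\xi)\ge u(\xi_0)+p\cdot(\mathrm{Pr}_1(\xi)-\mathrm{Pr}_1(\xi_0))\ \forall\xi\in\Omega\cap H_{\xi_0}\}$, $\partial_Hu(E)=\bigcup_{\xi\in E}\partial_Hu(\xi)$. Horizontal slicing measure: $\mathcal L^{2n}_{HS}(\partial_Hu(\Omega))=\sup_{\xi\in\Omega}\mathcal L^{2n}(\partial_Hu(\Omega\cap H_\xi))$, $\mathcal L^{2n}$ Lebesgue measure on $\mathbb R^{2n}$. *)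

theory Defs
  imports "HOL-Analysis.Analysis"
begin

text \<open>Points of the Heisenberg group H^n, with z = x + i y, are encoded as (x, y, t)
  with x, y :: real^'n and t :: real.  CARD('n) = n.\<close>

type_synonym 'n heis = "(real^'n) \<times> (real^'n) \<times> real"

definition hx :: "'n::finite heis \<Rightarrow> real^'n" where "hx p = fst p"
definition hy :: "'n::finite heis \<Rightarrow> real^'n" where "hy p = fst (snd p)"
definition ht :: "'n::finite heis \<Rightarrow> real" where "ht p = snd (snd p)"

text \<open>Group law: Im<z,z'> = y.x' - x.y'.\<close>
definition hmult :: "'n::finite heis \<Rightarrow> 'n heis \<Rightarrow> 'n heis" (infixl "\<circ>\<^sub>H" 70) where
  "p \<circ>\<^sub>H q = (hx p + hx q, hy p + hy q,
      ht p + ht q + 2 * (hy p \<bullet> hx q - hx p \<bullet> hy q))"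

definition hinv :: "'n::finite heis \<Rightarrow> 'n heis" where
  "hinv p = (- hx p, - hy p, - ht p)"

definition hdil :: "real \<Rightarrow> 'n::finite heis \<Rightarrow> 'n heis" where
  "hdil l p = (l *\<^sub>R hx p, l *\<^sub>R hy p, l ^ 2 * ht p)"

definition hplane :: "'n::finite heis \<Rightarrow> 'n heis set" where
  "hplane p0 = {p. ht p = ht p0 + 2 * (hx p \<bullet> hy p0 - hx p0 \<bullet> hy p)}"

definition Pr1 :: "'n::finite heis \<Rightarrow> (real^'n) \<times> (real^'n)" where
  "Pr1 p = (hx p, hy p)"

definition hgauge :: "'n::finite heis \<Rightarrow> real" where
  "hgauge p = ((norm (hx p) ^ 2 + norm (hy p) ^ 2) ^ 2 + (ht p) ^ 2) powr (1/4)"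

definition dH :: "'n::finite heis \<Rightarrow> 'n heis \<Rightarrow> real" where
  "dH p q = hgauge (hinv q \<circ>\<^sub>H p)"

definition distH :: "'n::finite heis \<Rightarrow> 'n heis set \<Rightarrow> real" where
  "distH p A = (INF q\<in>A. dH p q)"

definition diamH :: "'n::finite heis set \<Rightarrow> real" where
  "diamH A = (SUP pq\<in>A \<times> A. dH (fst pq) (snd pq))"

definition hconvex_fun :: "'n::finite heis set \<Rightarrow> ('n heis \<Rightarrow> real) \<Rightarrow> bool" where
  "hconvex_fun S u \<longleftrightarrow>
     (\<forall>p1\<in>S. \<forall>p2\<in>S. \<forall>l::real. p1 \<in> hplane p2 \<and> 0 \<le> l \<and> l \<le> 1 \<longrightarrow>
        u (p1 \<circ>\<^sub>H hdil l (hinv p1 \<circ>\<^sub>H p2)) \<le> (1 - l) * u p1 + l * u p2)"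

definition horiz_bounded :: "'n::finite heis set \<Rightarrow> bool" where
  "horiz_bounded \<Omega> \<longleftrightarrow> (\<exists>M. \<forall>p\<in>\<Omega>. \<forall>a\<in>\<Omega> \<inter> hplane p. \<forall>b\<in>\<Omega> \<inter> hplane p. dH a b \<le> M)"

definition diamHS :: "'n::finite heis set \<Rightarrow> real" where
  "diamHS \<Omega> = (SUP p\<in>\<Omega>. diamH (\<Omega> \<inter> hplane p))"

definition hsubdiff :: "'n::finite heis set \<Rightarrow> ('n heis \<Rightarrow> real) \<Rightarrow> 'n heis
    \<Rightarrow> ((real^'n) \<times> (real^'n)) set" where
  "hsubdiff \<Omega> u p0 = {v. \<forall>p\<in>\<Omega> \<inter> hplane p0. u p \<ge> u p0 + v \<bullet> (Pr1 p - Pr1 p0)}"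

definition hsubdiff_set :: "'n::finite heis set \<Rightarrow> ('n heis \<Rightarrow> real) \<Rightarrow> 'n heis set
    \<Rightarrow> ((real^'n) \<times> (real^'n)) set" where
  "hsubdiff_set \<Omega> u E = (\<Union>p\<in>E. hsubdiff \<Omega> u p)"

text \<open>Lebesgue (outer) measure on R^{2n}; coincides with the Lebesgue measure on
  Lebesgue measurable sets.\<close>
definition leb_outer :: "((real^'n::finite) \<times> (real^'n)) set \<Rightarrow> ennreal" where
  "leb_outer A = (INF B\<in>{B\<in>sets lebesgue. A \<subseteq> B}. emeasure lebesgue B)"

definition LHS_measure :: "'n::finite heis set \<Rightarrow> ('n heis \<Rightarrow> real) \<Rightarrow> ennreal" where
  "LHS_measure \<Omega> u = (SUP p\<in>\<Omega>. leb_outer (hsubdiff_set \<Omega> u (\<Omega> \<inter> hplane p)))"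

end

(*
  The proof reduces everything to one horizontal slice. For an H-convex u and a base point xi in
  Omega, let D be the projection of the slice of Omega by the horizontal plane at xi, and let p
  satisfy p . (z - Pr1 xi) < - u xi on the closure of D. Then p lies in the horizontal
  subdifferential of u at some point of the slice. Otherwise every z in the closure of D has a
  "bad" direction w, that is, u decreases too fast from the lift of z towards w inside the
  horizontal plane at that lift; at boundary points w = Pr1 xi works because u vanishes there.
  Gluing the bad w by a partition of unity and applying Brouwer's theorem gives a z that is a convex
  combination of bad w for z itself, which contradicts Jensen's inequality with barycentre at the
  base point of a horizontal plane. That Jensen inequality holds because averaging u in the central
  direction t keeps H-convexity and makes u Lipschitz in t, so that within distance r of the base
  point u is convex on the horizontal plane up to an error O(r^2).

  If the slice lies in a half-space at distance H from Pr1 xi, the set of admissible p contains a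
  capsule of length |u xi| / (2 H) and radius |u xi| / (2 diam_HS), which gives the estimate with H
  in place of the distance. Finally, let q be a boundary point at distance d from xi and take a
  supporting hyperplane of Omega at q. If its trace on the slice at xi is not within 2d, the
  hyperplane is nearly parallel to the horizontal plane at xi, and moving xi horizontally by 2d in
  any direction tilts the horizontal plane enough for it to meet the hyperplane within 4d; convexity of u along that horizontal line
  loses only a factor 2 in |u|, unless the line leaves Omega within distance 4d, in which case the
  slice at xi already has a boundary point within 4d.
*)
theory Submission
  imports Defs
begin

section \<open>Horizontal lifts and segments\<close>

text \<open>The standard symplectic form on R^{2n}, equal to -Im<a, b> in complex notation; the
  height correction in the group law is -2 times it.\<close>

definition hsymp :: "(real^'n::finite) \<times> (real^'n) \<Rightarrow> (real^'n) \<times> (real^'n) \<Rightarrow> real" where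
  "hsymp a b = fst a \<bullet> snd b - fst b \<bullet> snd a"

text \<open>Multiplication by -i, so that the symplectic form becomes an inner product and
  Cauchy-Schwarz applies.\<close>

definition Jrot :: "(real^'n::finite) \<times> (real^'n) \<Rightarrow> (real^'n) \<times> (real^'n)" where
  "Jrot a = (snd a, - fst a)"

text \<open>An affine parametrisation of \<open>hplane p\<close> by its projection, inverse to
  \<open>Pr1\<close> on that plane.\<close>

definition hlift :: "'n::finite heis \<Rightarrow> (real^'n) \<times> (real^'n) \<Rightarrow> 'n heis" where
  "hlift p w = (fst w, snd w, ht p + 2 * hsymp w (Pr1 p))"

text \<open>The centre of the group; adding \<open>vert s\<close> is translation by a central
  element.\<close>

definition vert :: "real \<Rightarrow> 'n::finite heis" where
  "vert s = (0, 0, s)"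

lemmas heis_defs = hsymp_def hlift_def hx_def hy_def ht_def Pr1_def vert_def

lemma hsymp_eq_inner: "hsymp a b = a \<bullet> Jrot b"
  by (simp add: hsymp_def Jrot_def inner_prod_def inner_commute)

lemma norm_Jrot [simp]: "norm (Jrot a) = norm a"
  by (simp add: Jrot_def norm_prod_def add.commute)

lemma Jrot_add: "Jrot (a + b) = Jrot a + Jrot b"
  by (simp add: Jrot_def)

lemma hsymp_self [simp]: "hsymp a a = 0"
  by (simp add: hsymp_def)

lemma hsymp_commute: "hsymp a b = - hsymp b a"
  by (simp add: hsymp_def)

lemma hsymp_add_left: "hsymp (a + b) c = hsymp a c + hsymp b c"
  by (simp add: hsymp_eq_inner inner_left_distrib)

lemma hsymp_diff_left: "hsymp (a - b) c = hsymp a c - hsymp b c"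
  by (simp add: hsymp_eq_inner inner_diff_left)

lemma hsymp_scaleR_left: "hsymp (c *\<^sub>R a) b = c * hsymp a b"
  by (simp add: hsymp_eq_inner)

lemma hsymp_add_right: "hsymp c (a + b) = hsymp c a + hsymp c b"
  by (simp add: hsymp_commute [of c] hsymp_add_left)

lemma hsymp_diff_right: "hsymp c (a - b) = hsymp c a - hsymp c b"
  by (simp add: hsymp_commute [of c] hsymp_diff_left)

lemma hsymp_scaleR_right: "hsymp a (c *\<^sub>R b) = c * hsymp a b"
  by (simp add: hsymp_commute [of a] hsymp_scaleR_left)

lemmas hsymp_linear = hsymp_add_left hsymp_diff_left hsymp_scaleR_left
  hsymp_add_right hsymp_diff_right hsymp_scaleR_right

lemma abs_hsymp_le: "\<bar>hsymp a b\<bar> \<le> norm a * norm b"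
  unfolding hsymp_eq_inner using Cauchy_Schwarz_ineq2[of a "Jrot b"] by simp

lemma Pr1_hlift [simp]: "Pr1 (hlift p w) = w"
  by (simp add: heis_defs)

lemma ht_hlift [simp]: "ht (hlift p w) = ht p + 2 * hsymp w (Pr1 p)"
  by (simp add: heis_defs)

lemma heis_eq_iff: "p = q \<longleftrightarrow> Pr1 p = Pr1 q \<and> ht p = ht q"
  by (cases p, cases q) (auto simp: heis_defs)

lemma Pr1_add [simp]: "Pr1 (p + q) = Pr1 p + Pr1 q"
  and Pr1_diff [simp]: "Pr1 (p - q) = Pr1 p - Pr1 q"
  and Pr1_scaleR [simp]: "Pr1 (c *\<^sub>R p) = c *\<^sub>R Pr1 p"
  and Pr1_vert [simp]: "Pr1 (vert s) = 0"
  and ht_add [simp]: "ht (p + q) = ht p + ht q"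
  and ht_diff [simp]: "ht (p - q) = ht p - ht q"
  and ht_scaleR [simp]: "ht (c *\<^sub>R p) = c * ht p"
  and ht_vert [simp]: "ht (vert s) = s"
  by (simp_all add: heis_defs zero_prod_def)

lemma vert_0 [simp]: "vert 0 = 0"
  by (simp add: vert_def zero_prod_def)

lemma vert_add: "vert (a + b) = vert a + vert b"
  by (simp add: vert_def)

lemma norm_vert [simp]: "norm (vert s) = \<bar>s\<bar>"
  by (simp add: vert_def norm_prod_def)

lemma inner_heis: "p \<bullet> q = Pr1 p \<bullet> Pr1 q + ht p * ht q"
  by (simp add: heis_defs inner_prod_def)

lemma mem_hplane_iff: "q \<in> hplane p \<longleftrightarrow> ht q = ht p + 2 * hsymp (Pr1 q) (Pr1 p)"
  by (auto simp: hplane_def heis_defs)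

lemma hplane_eq_range: "hplane p = range (hlift p)"
proof -
  have "q = hlift p (Pr1 q)" if "q \<in> hplane p" for q
    using that by (simp add: heis_eq_iff mem_hplane_iff)
  then have "hplane p \<subseteq> range (hlift p)"
    by blast
  moreover have "range (hlift p) \<subseteq> hplane p"
    by (auto simp: mem_hplane_iff simp del: split_paired_All)
  ultimately show ?thesis
    by blast
qed

lemma hplane_sym: "q \<in> hplane p \<Longrightarrow> p \<in> hplane q"
  by (auto simp: mem_hplane_iff hsymp_commute[of "Pr1 p"])

lemma hlift_Pr1 [simp]: "hlift p (Pr1 p) = p"
  by (simp add: heis_eq_iff)

lemma hlift_convex_comb:
  "hlift p ((1 - l) *\<^sub>R a + l *\<^sub>R b) = (1 - l) *\<^sub>R hlift p a + l *\<^sub>R hlift p b"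
  by (simp add: heis_eq_iff hsymp_linear algebra_simps)

text \<open>Moving the base point within its own plane tilts the plane. The height error is bilinear
  in the displacements from \<open>Pr1 p\<close>, hence quadratic near \<open>p\<close>; this is the
  source of the O(r^2) error in Jensen's inequality.\<close>

lemma hlift_hlift: "hlift (hlift p a) b = hlift p b + vert (2 * hsymp (b - Pr1 p) (a - Pr1 p))"
  by (simp add: heis_eq_iff hsymp_linear hsymp_commute[of "Pr1 p"])

lemma hlift_hlift_Pr1 [simp]: "hlift (hlift p a) (Pr1 p) = p"
  by (simp add: hlift_hlift hsymp_def)

lemma continuous_on_hlift [continuous_intros]:
  assumes "continuous_on S f" "continuous_on S g"
  shows "continuous_on S (\<lambda>x. hlift (f x) (g x))"
  unfolding heis_defs by (intro continuous_intros assms)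

lemma continuous_on_vert [continuous_intros]:
  assumes "continuous_on S f"
  shows "continuous_on S (\<lambda>x. vert (f x))"
  unfolding vert_def by (intro continuous_intros assms)

section \<open>H-convexity along Euclidean segments\<close>

text \<open>The increment from \<open>p\<close> to \<open>q\<close> has height zero when the points
  are horizontally related, so the dilation acts on it linearly.\<close>

lemma hmult_hdil_segment:
  assumes "p \<in> hplane q"
  shows "p \<circ>\<^sub>H hdil l (hinv p \<circ>\<^sub>H q) = (1 - l) *\<^sub>R p + l *\<^sub>R q"
proof -
  have t: "ht p = ht q + 2 * (hx p \<bullet> hy q - hx q \<bullet> hy p)"
    using assms by (simp add: hplane_def)
  have eq: "- ht p + ht q + 2 * (hx p \<bullet> hy q - hy p \<bullet> hx q) = 0"
    unfolding t by (simp add: inner_commute)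
  have "ht (hinv p \<circ>\<^sub>H q) = 0"
    using eq by (simp add: hmult_def hinv_def hx_def hy_def ht_def)
  moreover have "hx (hinv p \<circ>\<^sub>H q) = hx q - hx p" "hy (hinv p \<circ>\<^sub>H q) = hy q - hy p"
    by (simp_all add: hmult_def hinv_def hx_def hy_def ht_def)
  ultimately have "hdil l (hinv p \<circ>\<^sub>H q) = (l *\<^sub>R (hx q - hx p), l *\<^sub>R (hy q - hy p), 0)"
    by (simp add: hdil_def)
  then have "p \<circ>\<^sub>H hdil l (hinv p \<circ>\<^sub>H q) = (hx p + l *\<^sub>R (hx q - hx p), hy p + l *\<^sub>R (hy q - hy p),
      ht p + 2 * l * (hy p \<bullet> hx q - hx p \<bullet> hy q))"
    by (simp add: hmult_def hx_def hy_def ht_def inner_diff_right inner_commute algebra_simps)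
  also have "2 * l * (hy p \<bullet> hx q - hx p \<bullet> hy q) = l * (ht q - ht p)"
  proof -
    have "ht q - ht p = 2 * (hy p \<bullet> hx q - hx p \<bullet> hy q)" using eq by simp
    then show ?thesis by simp
  qed
  also have "(hx p + l *\<^sub>R (hx q - hx p), hy p + l *\<^sub>R (hy q - hy p), ht p + l * (ht q - ht p))
     = (1 - l) *\<^sub>R p + l *\<^sub>R q"
    by (simp add: prod_eq_iff hx_def hy_def ht_def algebra_simps)
  finally show ?thesis .
qed

lemma hconvex_fun_iff_segment:
  "hconvex_fun S u \<longleftrightarrow> (\<forall>p\<in>S. \<forall>q\<in>S. \<forall>l. p \<in> hplane q \<and> 0 \<le> l \<and> l \<le> 1 \<longrightarrow>
     u ((1 - l) *\<^sub>R p + l *\<^sub>R q) \<le> (1 - l) * u p + l * u q)"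
  unfolding hconvex_fun_def by (auto simp: hmult_hdil_segment)

lemma hconvex_funD:
  assumes "hconvex_fun S u" "p \<in> S" "q \<in> S" "q \<in> hplane p" "0 \<le> l" "l \<le> 1"
  shows "u ((1 - l) *\<^sub>R p + l *\<^sub>R q) \<le> (1 - l) * u p + l * u q"
  using assms hplane_sym unfolding hconvex_fun_iff_segment by blast

section \<open>Approximate convexity and averages over a moving window\<close>

text \<open>Points are merged one at a time, each merge costing at most \<open>E\<close>; convexity
  of \<open>B\<close> keeps the renormalised partial barycentres in the domain.\<close>

lemma approx_convex_sum:
  fixes f :: "'b::real_vector \<Rightarrow> real" and E :: real
  assumes "finite I" "I \<noteq> {}" "convex B" "0 \<le> E"
    and f: "\<And>x y l. x \<in> B \<Longrightarrow> y \<in> B \<Longrightarrow> 0 \<le> l \<Longrightarrow> l \<le> 1 \<Longrightarrow>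
          f ((1 - l) *\<^sub>R x + l *\<^sub>R y) \<le> (1 - l) * f x + l * f y + E"
    and "sum c I = 1" "\<And>i. i \<in> I \<Longrightarrow> 0 \<le> c i" "\<And>i. i \<in> I \<Longrightarrow> a i \<in> B"
  shows "f (\<Sum>i\<in>I. c i *\<^sub>R a i) \<le> (\<Sum>i\<in>I. c i * f (a i)) + real (card I) * E"
  using assms(1,2,6-)
proof (induct I arbitrary: c rule: finite_ne_induct)
  case (singleton i)
  then show ?case using \<open>0 \<le> E\<close> by simp
next
  case (insert i S)
  have nn: "0 \<le> c j" if "j \<in> S" for j using insert.prems that by auto
  have S: "sum c S = 1 - c i" using insert by simp
  show ?case
  proof (cases "c i = 1")
    case True
    then have z: "c j = 0" if "j \<in> S" for j
      using S nn that \<open>finite S\<close> sum_nonneg_eq_0_iff[of S c] by auto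
    have "(\<Sum>j\<in>S. c j *\<^sub>R a j) = 0" "(\<Sum>j\<in>S. c j * f (a j)) = 0"
      using z by simp_all
    then show ?thesis using insert \<open>0 \<le> E\<close> True by simp
  next
    case False
    have "0 \<le> sum c S" using nn by (simp add: sum_nonneg)
    with S False have pos: "0 < 1 - c i" by simp
    define k where "k = 1 - c i"
    have ci: "c i = 1 - k" and pos: "0 < k" using pos by (auto simp: k_def)
    define b where "b j = c j / k" for j
    have b1: "sum b S = 1" using S pos by (simp add: b_def ci flip: sum_divide_distrib)
    have b0: "0 \<le> b j" if "j \<in> S" for j using nn[OF that] pos by (simp add: b_def)
    have cb: "c j = k * b j" for j using pos by (simp add: b_def)
    have sumc1: "(\<Sum>j\<in>S. c j *\<^sub>R a j) = k *\<^sub>R (\<Sum>j\<in>S. b j *\<^sub>R a j)"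
      and sumc2: "(\<Sum>j\<in>S. c j * f (a j)) = k * (\<Sum>j\<in>S. b j * f (a j))"
      by (simp_all add: scaleR_sum_right sum_distrib_left cb mult.assoc)
    have IH: "f (\<Sum>j\<in>S. b j *\<^sub>R a j) \<le> (\<Sum>j\<in>S. b j * f (a j)) + real (card S) * E"
      using insert.hyps(4)[of b] b1 b0 insert.prems by auto
    have inB: "(\<Sum>j\<in>S. b j *\<^sub>R a j) \<in> B"
      using \<open>finite S\<close> \<open>convex B\<close> b1 b0 insert.prems by (intro convex_sum) auto
    have "(\<Sum>j\<in>insert i S. c j *\<^sub>R a j) = k *\<^sub>R (\<Sum>j\<in>S. b j *\<^sub>R a j) + c i *\<^sub>R a i"
      using insert.hyps sumc1 by simp
    also have "f \<dots> \<le> k * f (\<Sum>j\<in>S. b j *\<^sub>R a j) + c i * f (a i) + E"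
      using f[OF inB, of "a i" "c i"] insert.prems pos by (auto simp: k_def)
    also have "\<dots> \<le> k * ((\<Sum>j\<in>S. b j * f (a j)) + real (card S) * E) + c i * f (a i) + E"
      using IH pos by (simp add: mult_left_mono)
    also have "\<dots> = (\<Sum>j\<in>insert i S. c j * f (a j)) + k * real (card S) * E + E"
      using insert.hyps sumc2 by (simp add: algebra_simps)
    also have "k * real (card S) * E \<le> 1 * real (card S) * E"
      using insert.prems \<open>0 \<le> E\<close> by (intro mult_right_mono) (auto simp: k_def)
    finally show ?thesis using insert.hyps by (simp add: algebra_simps)
  qed
qed

text \<open>The two windows differ only by two end intervals of length \<open>h\<close>.\<close>

lemma integral_shift_le:
  fixes g :: "real \<Rightarrow> real"
  assumes g: "continuous_on {0..e + h} g" and "0 \<le> e" "0 \<le> h"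
    and M: "\<And>s. s \<in> {0..e + h} \<Longrightarrow> \<bar>g s\<bar> \<le> M"
  shows "\<bar>integral {0..e} (\<lambda>s. g (s + h)) - integral {0..e} g\<bar> \<le> 2 * M * h"
proof -
  have int: "g integrable_on {a..b}" if "0 \<le> a" "b \<le> e + h" for a b
    by (rule integrable_continuous_real, rule continuous_on_subset[OF g]) (use that in auto)
  have shift: "integral {0..e} (\<lambda>s. g (s + h)) = integral {h..e + h} g"
    using integral_shift_Icc_real[of 0 e g h] by (simp add: o_def add.commute)
  have "integral {0..h} g + integral {h..e + h} g = integral {0..e + h} g"
       "integral {0..e} g + integral {e..e + h} g = integral {0..e + h} g"
    using assms by (auto intro!: Henstock_Kurzweil_Integration.integral_combine int)
  then have eq: "integral {h..e + h} g - integral {0..e} g = integral {e..e + h} g - integral {0..h} g"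
    by simp
  have "\<bar>integral {0..h} g\<bar> \<le> M * (h - 0)"
    using assms(2,3) by (intro integral_bound[of _ _ g, unfolded real_norm_def] continuous_on_subset[OF g] M) auto
  moreover have "\<bar>integral {e..e + h} g\<bar> \<le> M * (e + h - e)"
    using assms(2,3) by (intro integral_bound[of _ _ g, unfolded real_norm_def] continuous_on_subset[OF g] M) auto
  ultimately show ?thesis unfolding shift eq by simp
qed

section \<open>Jensen's inequality centred at a base point\<close>

lemma tendsto_vert_shift:
  assumes "open \<Omega>" "continuous_on \<Omega> u" "q \<in> \<Omega>"
  shows "((\<lambda>s. u (q + vert s)) \<longlongrightarrow> u q) (nhds 0)"
    and "eventually (\<lambda>s. q + vert s \<in> \<Omega>) (nhds 0)"
proof -
  have "continuous_on UNIV (\<lambda>s. q + vert s)"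
    by (intro continuous_intros)
  then have c: "isCont (\<lambda>s. q + vert s) 0"
    by (simp add: continuous_on_eq_continuous_at)
  have t: "((\<lambda>s. q + vert s) \<longlongrightarrow> q) (nhds 0)"
    using c tendsto_at_iff_tendsto_nhds[of "\<lambda>s. q + vert s" 0] by (simp add: isCont_def)
  show "eventually (\<lambda>s. q + vert s \<in> \<Omega>) (nhds 0)"
    using topological_tendstoD[OF t assms(1,3)] .
  have "isCont u q"
    using assms continuous_on_eq_continuous_at by blast
  then have "(u \<longlongrightarrow> u q) (nhds q)"
    by (simp add: isCont_def tendsto_at_iff_tendsto_nhds)
  then show "((\<lambda>s. u (q + vert s)) \<longlongrightarrow> u q) (nhds 0)"
    using filterlim_compose t by blast
qed

text \<open>The lifted points need not lie in each other's horizontal planes, so H-convexity cannot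
  be iterated directly. Contracting them towards the centre by a factor t scales a supposed gap by t
  but the errors by t^2, which is contradictory for small t.\<close>

lemma jensen_center:
  fixes \<Omega> :: "'n::finite heis set"
  assumes op: "open \<Omega>" and cv: "convex \<Omega>" and cont: "continuous_on \<Omega> u"
    and hc: "hconvex_fun \<Omega> u" and xi: "\<xi> \<in> \<Omega>"
    and fin: "finite I" and c0: "\<And>i. i \<in> I \<Longrightarrow> 0 \<le> c i" and c1: "sum c I = 1"
    and w: "\<And>i. i \<in> I \<Longrightarrow> hlift \<xi> (w i) \<in> \<Omega>"
    and bary: "(\<Sum>i\<in>I. c i *\<^sub>R w i) = Pr1 \<xi>"
  shows "u \<xi> \<le> (\<Sum>i\<in>I. c i * u (hlift \<xi> (w i)))"
proof (rule ccontr)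
  assume neg: "\<not> ?thesis"
  \<comment> \<open>The failure of the inequality persists, by at least half, for all small vertical
    translates, so it survives averaging.\<close>
  define gap where "gap s = u (\<xi> + vert s) - (\<Sum>i\<in>I. c i * u (hlift \<xi> (w i) + vert s))" for s
  have gap0: "0 < gap 0" using neg by (simp add: gap_def)
  have "(gap \<longlongrightarrow> gap 0) (nhds 0)"
    unfolding gap_def
    by (simp, intro tendsto_intros tendsto_vert_shift[OF op cont] xi w) auto
  then have ev1: "eventually (\<lambda>s. gap 0 / 2 < gap s) (nhds 0)"
    using gap0 by (intro order_tendstoD) auto
  have ev2: "eventually (\<lambda>s. \<xi> + vert s \<in> \<Omega>) (nhds 0)"
    by (rule tendsto_vert_shift[OF op cont xi])
  have ev3: "eventually (\<lambda>s. \<forall>i\<in>I. hlift \<xi> (w i) + vert s \<in> \<Omega>) (nhds 0)"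
    by (rule eventually_ball_finite[OF fin]) (use tendsto_vert_shift[OF op cont] w in auto)
  obtain d where d: "0 < d" and d': "\<And>s. \<bar>s\<bar> < d \<Longrightarrow> gap 0 / 2 < gap s \<and> \<xi> + vert s \<in> \<Omega> \<and>
      (\<forall>i\<in>I. hlift \<xi> (w i) + vert s \<in> \<Omega>)"
    using eventually_conj[OF ev1 eventually_conj[OF ev2 ev3]]
    unfolding eventually_nhds_metric by (auto simp: dist_real_def)
  obtain R where R: "0 < R" "cball \<xi> R \<subseteq> \<Omega>"
    using op xi open_contains_cball by blast
  have "bounded (u ` cball \<xi> R)"
    by (intro compact_imp_bounded compact_continuous_image continuous_on_subset[OF cont] R compact_cball)
  then obtain M where M: "0 < M" and M': "\<And>q. q \<in> cball \<xi> R \<Longrightarrow> \<bar>u q\<bar> \<le> M"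
    unfolding bounded_pos by auto
  \<comment> \<open>Vertical translation is left translation by a central element, so the average V inherits
    H-convexity; in addition it is Lipschitz in t.\<close>
  define e where "e = min (d / 2) (R / 4)"
  have e: "0 < e" "e < d" "e \<le> R / 4" using d R by (auto simp: e_def)
  define V where "V q = integral {0..e} (\<lambda>s. u (q + vert s))" for q
  have int: "(\<lambda>s. u (q + vert s)) integrable_on {0..e}"
    if "\<And>s. s \<in> {0..e} \<Longrightarrow> q + vert s \<in> \<Omega>" for q
    by (intro integrable_continuous_real continuous_on_compose2[OF cont] continuous_intros) (use that in auto)
  \<comment> \<open>The distance of \<open>q\<close>, the shift and the window each use at most R/4,
    so every point met stays in the ball where \<open>M\<close> bounds \<open>u\<close>.\<close>
  have V_vert0: "\<bar>V (q + vert h) - V q\<bar> \<le> 2 * M * h"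
    if "q \<in> cball \<xi> (R/4)" "0 \<le> h" "h \<le> R / 4" for q h
  proof -
    have inR: "q + vert s \<in> cball \<xi> R" if "s \<in> {0..e + h}" for s
    proof -
      have "dist \<xi> (q + vert s) \<le> dist \<xi> q + dist q (q + vert s)" by (rule dist_triangle)
      also have "\<dots> \<le> R / 4 + (R / 4 + R / 4)"
        using \<open>q \<in> cball \<xi> (R/4)\<close> that e \<open>h \<le> R / 4\<close> by (auto simp: dist_norm)
      finally show ?thesis using R by simp
    qed
    have "continuous_on {0..e + h} (\<lambda>s. u (q + vert s))"
      by (intro continuous_on_compose2[OF cont] continuous_intros) (use inR R in auto)
    from integral_shift_le[OF this, of M] show ?thesis
      using that e inR M' unfolding V_def by (auto simp: vert_add ac_simps)
  qed
  have V_vert: "\<bar>V (q + vert h) - V q\<bar> \<le> 2 * M * \<bar>h\<bar>"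
    if "q \<in> cball \<xi> (R/4)" "q + vert h \<in> cball \<xi> (R/4)" "\<bar>h\<bar> \<le> R / 4" for q h
  proof (cases "0 \<le> h")
    case True
    then show ?thesis using V_vert0[of q h] that by auto
  next
    case False
    have "q + vert h + vert (- h) = q" by (simp add: add.assoc flip: vert_add)
    from V_vert0[of "q + vert h" "- h", unfolded this] show ?thesis using that False by (auto simp: abs_minus_commute)
  qed
  have V_conv: "V ((1 - l) *\<^sub>R P + l *\<^sub>R Q) \<le> (1 - l) * V P + l * V Q"
    if P: "\<And>s. s \<in> {0..e} \<Longrightarrow> P + vert s \<in> \<Omega>" and Q: "\<And>s. s \<in> {0..e} \<Longrightarrow> Q + vert s \<in> \<Omega>"
      and PQ: "Q \<in> hplane P" and l: "0 \<le> l" "l \<le> 1" for P Q l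
  proof -
    have eq: "(1 - l) *\<^sub>R P + l *\<^sub>R Q + vert s = (1 - l) *\<^sub>R (P + vert s) + l *\<^sub>R (Q + vert s)" for s
      by (simp add: algebra_simps)
    have inO: "(1 - l) *\<^sub>R P + l *\<^sub>R Q + vert s \<in> \<Omega>" if "s \<in> {0..e}" for s
      unfolding eq using that P Q l cv by (intro convexD) auto
    have "V ((1 - l) *\<^sub>R P + l *\<^sub>R Q) \<le> integral {0..e} (\<lambda>s. (1 - l) * u (P + vert s) + l * u (Q + vert s))"
      unfolding V_def
    proof (intro integral_le integrable_add integrable_on_mult_right int inO P Q)
      fix s assume s: "s \<in> {0..e}"
      have "Q + vert s \<in> hplane (P + vert s)"
        using PQ by (simp add: mem_hplane_iff)
      then show "u ((1 - l) *\<^sub>R P + l *\<^sub>R Q + vert s) \<le> (1 - l) * u (P + vert s) + l * u (Q + vert s)"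
        unfolding eq using P Q s l by (intro hconvex_funD[OF hc]) auto
    qed auto
    also have "\<dots> = (1 - l) * V P + l * V Q"
      unfolding V_def
      by (subst integral_add) (auto intro!: integrable_on_mult_right int P Q)
    finally show ?thesis .
  qed
  have V_gap: "(\<Sum>i\<in>I. c i * V (hlift \<xi> (w i))) \<le> V \<xi> - e * (gap 0 / 2)"
  proof -
    have iw: "(\<lambda>s. u (hlift \<xi> (w i) + vert s)) integrable_on {0..e}" if "i \<in> I" for i
      using d' e that by (intro int) auto
    have ix: "(\<lambda>s. u (\<xi> + vert s)) integrable_on {0..e}"
      using d' e by (intro int) auto
    have "(\<Sum>i\<in>I. c i * V (hlift \<xi> (w i))) = integral {0..e} (\<lambda>s. \<Sum>i\<in>I. c i * u (hlift \<xi> (w i) + vert s))"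
      unfolding V_def using fin iw by (simp add: integral_sum integrable_on_mult_right)
    also have "\<dots> \<le> integral {0..e} (\<lambda>s. u (\<xi> + vert s) - gap 0 / 2)"
    proof (intro integral_le integrable_sum integrable_on_mult_right integrable_diff iw ix fin)
      fix s assume "s \<in> {0..e}"
      then have "gap 0 / 2 < gap s" using d' e by auto
      then show "(\<Sum>i\<in>I. c i * u (hlift \<xi> (w i) + vert s)) \<le> u (\<xi> + vert s) - gap 0 / 2"
        unfolding gap_def[of s] by simp
    qed auto
    also have "\<dots> = V \<xi> - e * (gap 0 / 2)"
      unfolding V_def using ix e by (subst integral_diff) auto
    finally show ?thesis .
  qed
  define z where "z = Pr1 \<xi>"
  define H where "H a = V (hlift \<xi> (z + a))" for a
  have H0: "H 0 = V \<xi>" by (simp add: H_def z_def)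
  have "isCont (\<lambda>a. hlift \<xi> (z + a)) 0"
  proof -
    have "continuous_on UNIV (\<lambda>a. hlift \<xi> (z + a))" by (intro continuous_intros)
    then show ?thesis using continuous_on_eq_continuous_at[OF open_UNIV] by blast
  qed
  then obtain r1 where r1: "0 < r1" "\<And>a. norm a < r1 \<Longrightarrow> dist (hlift \<xi> (z + a)) \<xi> < R / 8"
    using R unfolding continuous_at_eps_delta
    by (auto simp: z_def dest!: spec[of _ "R / 8"])
  \<comment> \<open>The bound 1 turns r^2 into at most \<open>\<rho>\<close>, and R/16 then keeps
    the vertical correction 2 r^2 below R/8.\<close>
  define \<rho> where "\<rho> = min (r1 / 2) (min 1 (R / 16))"
  have rho: "0 < \<rho>" "\<rho> < r1" "\<rho> \<le> 1" "\<rho> \<le> R / 16" using r1 R by (auto simp: \<rho>_def)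
  have near: "hlift \<xi> (z + a) \<in> cball \<xi> (R/8)" if "norm a \<le> \<rho>" for a
    using r1(2)[of a] rho that by (auto simp: dist_commute)
  \<comment> \<open>Shifting \<open>Q\<close> vertically by \<open>\<tau>\<close> puts it into the
    horizontal plane at \<open>P\<close>. The Lipschitz bound in t is paid twice, at
    \<open>Q\<close> and at the intermediate point, each time at most 4 M r^2.\<close>
  have H_approx: "H ((1 - l) *\<^sub>R a + l *\<^sub>R b) \<le> (1 - l) * H a + l * H b + 8 * M * r\<^sup>2"
    if a: "norm a \<le> r" and b: "norm b \<le> r" and r: "r \<le> \<rho>" and l: "0 \<le> l" "l \<le> 1" for a b l r
  proof -
    have r0: "0 \<le> r" using a norm_ge_zero order_trans by blast
    define \<tau> where "\<tau> = 2 * hsymp b a"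
    have "\<bar>hsymp b a\<bar> \<le> r * r"
      using abs_hsymp_le[of b a] mult_mono[OF b a] r0 by simp
    then have tau: "\<bar>\<tau>\<bar> \<le> 2 * r\<^sup>2" by (simp add: \<tau>_def power2_eq_square abs_mult)
    have "r\<^sup>2 \<le> \<rho> * 1" unfolding power2_eq_square using r r0 rho by (intro mult_mono) auto
    then have tau': "\<bar>\<tau>\<bar> \<le> R / 8" using tau rho by simp
    have ltau: "\<bar>l * \<tau>\<bar> \<le> \<bar>\<tau>\<bar>" using l by (simp add: abs_mult mult_left_le_one_le)
    define P where "P = hlift \<xi> (z + a)"
    define Q where "Q = hlift \<xi> (z + b)"
    define m where "m = hlift \<xi> (z + ((1 - l) *\<^sub>R a + l *\<^sub>R b))"
    have nab: "norm ((1 - l) *\<^sub>R a + l *\<^sub>R b) \<le> r"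
      using convexD[OF convex_cball, of a 0 r b "1 - l" l] a b l by simp
    have PQ: "P \<in> cball \<xi> (R/8)" "Q \<in> cball \<xi> (R/8)" "m \<in> cball \<xi> (R/8)"
      unfolding P_def Q_def m_def using near[of a] near[of b] near[OF order_trans[OF nab r]] a b r by auto
    have shift: "q + vert s \<in> cball \<xi> (R/8 + \<bar>s\<bar>)" if "q \<in> cball \<xi> (R/8)" for q s
      using that dist_triangle[of \<xi> "q + vert s" q] by (auto simp: dist_norm)
    have Q': "Q + vert \<tau> = hlift P (z + b)"
      by (simp add: P_def Q_def \<tau>_def hlift_hlift z_def)
    have hpl: "Q + vert \<tau> \<in> hplane P" unfolding Q' hplane_eq_range by simp
    have comb: "(1 - l) *\<^sub>R P + l *\<^sub>R (Q + vert \<tau>) = m + vert (l * \<tau>)"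
    proof -
      have zeq: "z + ((1 - l) *\<^sub>R a + l *\<^sub>R b) = (1 - l) *\<^sub>R (z + a) + l *\<^sub>R (z + b)"
        by (simp add: algebra_simps)
      have vl: "vert (l * \<tau>) = l *\<^sub>R vert \<tau>" by (simp add: vert_def)
      show ?thesis
        unfolding m_def P_def Q_def zeq vl hlift_convex_comb by (simp add: scaleR_add_right)
    qed
    have inO: "q + vert s \<in> \<Omega>"
      if "q \<in> cball \<xi> (R/4)" "s \<in> {0..e}" for q s
    proof -
      have "dist \<xi> (q + vert s) \<le> R"
        using dist_triangle[of \<xi> "q + vert s" q] that e R by (auto simp: dist_norm)
      then show "q + vert s \<in> \<Omega>" using R by auto
    qed
    have in4: "Q + vert \<tau> \<in> cball \<xi> (R/4)" "m + vert (l * \<tau>) \<in> cball \<xi> (R/4)"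
      "P \<in> cball \<xi> (R/4)" "Q \<in> cball \<xi> (R/4)" "m \<in> cball \<xi> (R/4)"
      using shift[OF PQ(2), of \<tau>] shift[OF PQ(3), of "l * \<tau>"] tau' ltau PQ R by auto
    have "V (m + vert (l * \<tau>)) \<le> (1 - l) * V P + l * V (Q + vert \<tau>)"
      unfolding comb[symmetric] using in4 inO l by (intro V_conv hpl) auto
    moreover have "\<bar>V (Q + vert \<tau>) - V Q\<bar> \<le> 2 * M * \<bar>\<tau>\<bar>"
      using in4 tau' R by (intro V_vert) auto
    then have "V (Q + vert \<tau>) \<le> V Q + 2 * M * \<bar>\<tau>\<bar>" by linarith
    then have "l * V (Q + vert \<tau>) \<le> l * V Q + l * (2 * M * \<bar>\<tau>\<bar>)"
      using l by (metis distrib_left mult_left_mono)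
    moreover have "l * (2 * M * \<bar>\<tau>\<bar>) \<le> 2 * M * \<bar>\<tau>\<bar>"
      using l M by (intro mult_left_le_one_le) auto
    moreover have "\<bar>V (m + vert (l * \<tau>)) - V m\<bar> \<le> 2 * M * \<bar>l * \<tau>\<bar>"
      using in4 tau' ltau R by (intro V_vert) auto
    moreover have "2 * M * \<bar>l * \<tau>\<bar> \<le> 2 * M * \<bar>\<tau>\<bar>" using ltau M by simp
    moreover have "2 * M * \<bar>\<tau>\<bar> \<le> 4 * M * r\<^sup>2"
      using tau M by (simp add: mult_left_mono)
    ultimately have "V m \<le> (1 - l) * V P + l * V Q + 8 * M * r\<^sup>2" by linarith
    then show ?thesis by (simp add: H_def P_def Q_def m_def)
  qed
  define a where "a i = w i - z" for i
  have I_ne: "I \<noteq> {}" using c1 by auto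
  have asum: "(\<Sum>i\<in>I. c i *\<^sub>R a i) = 0"
    using bary by (simp add: a_def scaleR_diff_right sum_subtractf c1 z_def flip: scaleR_sum_left)
  define B where "B = (\<Sum>i\<in>I. norm (a i)) + 1"
  have B: "norm (a i) \<le> B" if "i \<in> I" for i
    unfolding B_def using member_le_sum[of i I "\<lambda>i. norm (a i)"] fin that by auto
  have B0: "0 < B" unfolding B_def by (simp add: add_nonneg_pos sum_nonneg)
  \<comment> \<open>Segments starting at the centre are truly horizontal, so here convexity holds
    without error.\<close>
  have ray: "H (t *\<^sub>R a i) \<le> (1 - t) * H 0 + t * V (hlift \<xi> (w i))"
    if i: "i \<in> I" and t: "0 \<le> t" "t \<le> 1" for i t
  proof -
    have "z + t *\<^sub>R a i = (1 - t) *\<^sub>R z + t *\<^sub>R w i" by (simp add: a_def algebra_simps)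
    then have "hlift \<xi> (z + t *\<^sub>R a i) = (1 - t) *\<^sub>R \<xi> + t *\<^sub>R hlift \<xi> (w i)"
      by (simp add: hlift_convex_comb z_def)
    then show ?thesis
      unfolding H_def[of "t *\<^sub>R a i"] H0 using i t d' e
      by (auto intro!: V_conv simp: hplane_eq_range)
  qed
  \<comment> \<open>Comparison at scale t: the approximate Jensen inequality around 0 loses a
    quadratic amount, while the rays carry a linear share of the gap.\<close>
  have key: "t * (e * (gap 0 / 2)) \<le> card I * (8 * M * (t * B)\<^sup>2)" if t: "0 \<le> t" "t \<le> 1" "t * B \<le> \<rho>" for t
  proof -
    have nm: "norm (t *\<^sub>R a i) \<le> t * B" if "i \<in> I" for i
      using B[OF that] t by (simp add: mult_left_mono)
    have "H (\<Sum>i\<in>I. c i *\<^sub>R (t *\<^sub>R a i)) \<le> (\<Sum>i\<in>I. c i * H (t *\<^sub>R a i)) + card I * (8 * M * (t * B)\<^sup>2)"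
      using M t nm c0 c1
      by (intro approx_convex_sum[where B = "cball 0 (t * B)"] fin I_ne H_approx) auto
    also have "(\<Sum>i\<in>I. c i *\<^sub>R (t *\<^sub>R a i)) = t *\<^sub>R (\<Sum>i\<in>I. c i *\<^sub>R a i)"
      by (simp add: scaleR_sum_right mult.commute)
    also have "\<dots> = 0" by (simp add: asum)
    also have "(\<Sum>i\<in>I. c i * H (t *\<^sub>R a i)) \<le> (\<Sum>i\<in>I. c i * ((1 - t) * H 0 + t * V (hlift \<xi> (w i))))"
      using t c0 by (intro sum_mono mult_left_mono ray) auto
    also have "\<dots> = (\<Sum>i\<in>I. c i) * ((1 - t) * H 0) + t * (\<Sum>i\<in>I. c i * V (hlift \<xi> (w i)))"
      by (simp add: distrib_left sum.distrib sum_distrib_left sum_distrib_right mult.left_commute)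
    also have "\<dots> \<le> (1 - t) * H 0 + t * (H 0 - e * (gap 0 / 2))"
      using V_gap t by (simp add: c1 H0 mult_left_mono)
    finally show ?thesis by (simp add: algebra_simps)
  qed
  define K where "K = card I * (8 * M * B\<^sup>2)"
  have K: "0 < K" using I_ne fin M B0 by (simp add: K_def card_gt_0_iff)
  define g where "g = e * (gap 0 / 2)"
  have g: "0 < g" using e gap0 by (simp add: g_def)
  \<comment> \<open>The last term forces K t to be at most g/2, against g <= K t from
    \<open>key\<close>.\<close>
  define t where "t = min (min 1 (\<rho> / B)) (g / (2 * K))"
  have t: "0 < t" "t \<le> 1" "t \<le> \<rho> / B" "t \<le> g / (2 * K)" using rho B0 g K by (auto simp: t_def)
  have "t * B \<le> \<rho>" using t(3) B0 by (simp add: pos_le_divide_eq)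
  then have "t * g \<le> t * (K * t)"
    using key[of t] t unfolding g_def K_def by (simp add: power2_eq_square algebra_simps)
  then have "g \<le> K * t" using t by simp
  also have "\<dots> \<le> g / 2" using t(4) K by (simp add: field_simps)
  finally show False using g by simp
qed

section \<open>Subgradients from Brouwer's theorem\<close>

lemma hconvex_fun_subset: "hconvex_fun S u \<Longrightarrow> T \<subseteq> S \<Longrightarrow> hconvex_fun T u"
  unfolding hconvex_fun_iff_segment by blast

definition hslice :: "'n::finite heis set \<Rightarrow> 'n heis \<Rightarrow> ((real^'n) \<times> (real^'n)) set" where
  "hslice \<Omega> p = {z. hlift p z \<in> \<Omega>}"

lemma mem_hslice: "z \<in> hslice \<Omega> p \<longleftrightarrow> hlift p z \<in> \<Omega>"
  by (simp add: hslice_def)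

lemma Pr1_mem_hslice: "p \<in> \<Omega> \<Longrightarrow> Pr1 p \<in> hslice \<Omega> p"
  by (simp add: mem_hslice)

lemma convex_hslice: "convex \<Omega> \<Longrightarrow> convex (hslice \<Omega> p)"
  unfolding convex_alt by (simp add: mem_hslice hlift_convex_comb)

lemma open_hslice:
  assumes "open \<Omega>" shows "open (hslice \<Omega> p)"
proof -
  have "continuous_on UNIV (hlift p)"
    by (intro continuous_intros)
  from open_vimage[OF assms this] show ?thesis
    by (simp add: hslice_def vimage_def)
qed

lemma closure_hslice_subset: "closure (hslice \<Omega> p) \<subseteq> hslice (closure \<Omega>) p"
proof (rule closure_minimal)
  show "hslice \<Omega> p \<subseteq> hslice (closure \<Omega>) p"
    using closure_subset[of \<Omega>] by (auto simp: mem_hslice simp del: split_paired_All)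
  have "continuous_on UNIV (hlift p)"
    by (intro continuous_intros)
  from closed_vimage[OF closed_closure this] show "closed (hslice (closure \<Omega>) p)"
    by (simp add: hslice_def vimage_def)
qed

text \<open>The hypothesis on \<open>p\<close> says that the affine function through the value at
  \<open>\<xi>\<close> with slope \<open>p\<close> stays below the zero boundary values. Sliding it
  down to a contact point within one plane would not do, since each point of the slice is tested on
  its own horizontal plane; a fixed point argument replaces the minimisation.\<close>

proposition hsubdiff_covers:
  fixes \<Omega> :: "'n::finite heis set"
  assumes op: "open \<Omega>" and cv: "convex \<Omega>" and cont: "continuous_on (closure \<Omega>) u"
    and hc: "hconvex_fun \<Omega> u" and zero: "\<And>p. p \<in> frontier \<Omega> \<Longrightarrow> u p = 0"
    and xi: "\<xi> \<in> \<Omega>" and bd: "bounded (hslice \<Omega> \<xi>)"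
    and p: "\<And>z. z \<in> closure (hslice \<Omega> \<xi>) \<Longrightarrow> p \<bullet> (z - Pr1 \<xi>) < - u \<xi>"
  shows "p \<in> hsubdiff_set \<Omega> u (\<Omega> \<inter> hplane \<xi>)"
proof (rule ccontr)
  assume "\<not> ?thesis"
  then have no: "p \<notin> hsubdiff \<Omega> u q" if "q \<in> \<Omega>" "q \<in> hplane \<xi>" for q
    using that by (auto simp: hsubdiff_set_def)
  define D where "D = hslice \<Omega> \<xi>"
  define K where "K = closure D"
  have D: "convex D" "open D" "Pr1 \<xi> \<in> D" and D_iff: "\<And>z. z \<in> D \<longleftrightarrow> hlift \<xi> z \<in> \<Omega>"
    unfolding D_def using op cv xi by (auto intro: convex_hslice open_hslice Pr1_mem_hslice simp: mem_hslice)
  have DK: "D \<subseteq> K" unfolding K_def by (rule closure_subset)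
  have K: "compact K" "convex K" "K \<noteq> {}"
    using bd D DK by (auto simp: K_def D_def convex_closure)
  have K_cl: "hlift \<xi> z \<in> closure \<Omega>" if "z \<in> K" for z
    using that closure_hslice_subset[of \<Omega> \<xi>] by (auto simp: K_def D_def mem_hslice)
  \<comment> \<open>Negativity of \<open>f z w\<close> means that \<open>w\<close> violates the
    subgradient inequality for \<open>p\<close> at the lift of \<open>z\<close>.\<close>
  define f where "f z w = u (hlift (hlift \<xi> z) w) - u (hlift \<xi> z) - p \<bullet> (w - z)" for z w
  define G where "G w = {z \<in> K. hlift (hlift \<xi> z) w \<in> \<Omega> \<and> f z w < 0}" for w
  have ex: "\<exists>w\<in>D. z \<in> G w" if z: "z \<in> K" for z
  proof (cases "z \<in> D")
    case True
    define \<eta> where "\<eta> = hlift \<xi> z"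
    have eta: "\<eta> \<in> \<Omega>" "\<eta> \<in> hplane \<xi>" using True by (auto simp: \<eta>_def D_iff hplane_eq_range)
    obtain q where q: "q \<in> \<Omega>" "q \<in> hplane \<eta>" "u q < u \<eta> + p \<bullet> (Pr1 q - z)"
      using no[OF eta] by (auto simp: hsubdiff_def \<eta>_def not_le)
    define v where "v = Pr1 q"
    have q_eq: "q = hlift \<eta> v" using q(2) by (auto simp: v_def hplane_eq_range)
    obtain e where e: "0 < e" "ball z e \<subseteq> D" using D(2) True open_contains_ball by blast
    \<comment> \<open>The violating point may project outside \<open>D\<close>; H-convexity
      preserves the violation when it is pulled towards \<open>z\<close>, here to within distance
      \<open>e\<close>. The summand 1 keeps the denominator positive.\<close>
    define s where "s = min 1 (e / (2 * (norm (v - z) + 1)))"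
    have np: "0 < norm (v - z) + 1" by (simp add: add_nonneg_pos)
    have s: "0 < s" "s \<le> 1" using e np by (auto simp: s_def)
    have "s * norm (v - z) \<le> (e / (2 * (norm (v - z) + 1))) * (norm (v - z) + 1)"
      using e np by (intro mult_mono) (auto simp: s_def)
    also have "\<dots> = e / 2" using np by (simp add: field_simps)
    finally have small: "s * norm (v - z) < e" using e by simp
    define w where "w = (1 - s) *\<^sub>R z + s *\<^sub>R v"
    have wz: "w - z = s *\<^sub>R (v - z)" by (simp add: w_def algebra_simps)
    have "dist z w < e" using small wz s by (metis abs_of_pos dist_commute dist_norm norm_scaleR)
    then have "w \<in> D" using e by auto
    have lw: "hlift \<eta> w = (1 - s) *\<^sub>R \<eta> + s *\<^sub>R q"
      using hlift_Pr1[of \<eta>] by (simp add: w_def hlift_convex_comb q_eq \<eta>_def)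
    have "hlift \<eta> w \<in> \<Omega>"
      unfolding lw using cv eta q s by (intro convexD) auto
    moreover have "u (hlift \<eta> w) \<le> (1 - s) * u \<eta> + s * u q"
      unfolding lw using eta q s by (intro hconvex_funD[OF hc]) auto
    then have "f z w \<le> s * (u q - u \<eta> - p \<bullet> (v - z))"
      unfolding f_def wz by (simp add: \<eta>_def algebra_simps)
    moreover have "s * (u q - u \<eta> - p \<bullet> (v - z)) < 0"
      using s q(3) by (simp add: mult_pos_neg v_def)
    ultimately show ?thesis using \<open>w \<in> D\<close> z by (auto simp: G_def \<eta>_def)
  next
    case False
    then have "hlift \<xi> z \<in> frontier \<Omega>"
      using K_cl[OF z] op by (simp add: frontier_def D_iff interior_open)
    \<comment> \<open>Lifting back from the boundary point to \<open>Pr1 \<xi>\<close> returns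
      exactly \<open>\<xi>\<close>, and \<open>u\<close> vanishes at the boundary point.\<close>
    then have "f z (Pr1 \<xi>) < 0"
      using p[of z] z zero by (simp add: f_def K_def D_def inner_diff_right)
    then show ?thesis using D(3) z xi by (intro bexI[of _ "Pr1 \<xi>"]) (auto simp: G_def)
  qed
  have openG: "openin (top_of_set K) (G w)" for w
  proof -
    have contL: "continuous_on S (\<lambda>z. hlift (hlift \<xi> z) w)" for S
      by (intro continuous_intros)
    define A where "A = K \<inter> (\<lambda>z. hlift (hlift \<xi> z) w) -` \<Omega>"
    have A: "openin (top_of_set K) A"
      unfolding A_def by (intro continuous_openin_preimage_gen contL op)
    have "continuous_on A (\<lambda>z. f z w)"
      unfolding f_def
      by (intro continuous_intros continuous_on_compose2[OF cont])
        (use K_cl closure_subset[of \<Omega>] in \<open>auto simp: A_def\<close>)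
    then have "openin (top_of_set A) (A \<inter> (\<lambda>z. f z w) -` {..<0})"
      by (intro continuous_openin_preimage_gen) auto
    moreover have "A \<inter> (\<lambda>z. f z w) -` {..<0} = G w"
      by (auto simp: A_def G_def)
    ultimately show ?thesis using A openin_trans by fastforce
  qed
  have "K \<subseteq> \<Union>(G ` D)" using ex by blast
  with \<open>compact K\<close> openG obtain C where "C \<subseteq> G ` D" "finite C" "K \<subseteq> \<Union>C"
    unfolding compact_eq_openin_cover by (elim allE[of _ "G ` D"]) auto
  then obtain W where W: "W \<subseteq> D" "finite W" and KW: "K \<subseteq> \<Union>(G ` W)"
    using finite_subset_image by metis
  have "K \<noteq> UNIV" using compact_imp_bounded[OF K(1)] not_bounded_UNIV by auto
  \<comment> \<open>A point outside \<open>K\<close> keeps \<open>Z w\<close> nonempty even if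
    \<open>G w\<close> is all of \<open>K\<close>; \<open>infdist\<close> to the empty set would be
    0 by default.\<close>
  then obtain y where y: "y \<notin> K" by auto
  define Z where "Z w = insert y (K - G w)" for w
  define \<beta> where "\<beta> w z = infdist z (Z w)" for w z
  have "closed (K - G w)" for w
    using closedin_closed_trans[OF _ compact_imp_closed[OF K(1)]]
      closedin_diff[OF closedin_topspace openG[of w]] by simp
  then have Z: "closed (Z w)" "Z w \<noteq> {}" for w by (auto simp: Z_def)
  have \<beta>0: "0 \<le> \<beta> w z" for w z by (simp add: \<beta>_def infdist_nonneg)
  have \<beta>_eq0: "\<beta> w z = 0 \<longleftrightarrow> z \<notin> G w" if "z \<in> K" for w z
    using in_closed_iff_infdist_zero[OF Z, of z w] that y by (auto simp: \<beta>_def Z_def)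
  define s where "s z = (\<Sum>w\<in>W. \<beta> w z)" for z
  have s: "0 < s z" if z: "z \<in> K" for z
  proof -
    obtain w where w: "w \<in> W" "z \<in> G w" using KW z by blast
    then have "0 < \<beta> w z" using \<beta>_eq0[OF z, of w] \<beta>0[of w z] by simp
    then show ?thesis unfolding s_def using w W \<beta>0 by (intro sum_pos2) auto
  qed
  define T where "T z = (\<Sum>w\<in>W. (\<beta> w z / s z) *\<^sub>R w)" for z
  have s1: "(\<Sum>w\<in>W. \<beta> w z / s z) = 1" if "z \<in> K" for z
    using s[OF that] by (simp add: s_def flip: sum_divide_distrib)
  have TD: "T z \<in> D" if "z \<in> K" for z
    unfolding T_def using W D(1) s1[OF that] s[OF that] \<beta>0
    by (intro convex_sum) (auto simp: less_imp_le)
  have "continuous_on K T"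
    unfolding T_def s_def \<beta>_def
    by (intro continuous_intros) (use s in \<open>force simp: s_def \<beta>_def\<close>)
  then obtain z where z: "z \<in> K" "T z = z"
    using brouwer[OF K] TD DK by blast
  have zD: "z \<in> D" using TD z by metis
  define \<eta> where "\<eta> = hlift \<xi> z"
  have eta: "\<eta> \<in> \<Omega>" "Pr1 \<eta> = z" using zD by (auto simp: \<eta>_def D_iff)
  \<comment> \<open>At the fixed point exactly the bad directions for \<open>z\<close> carry
    positive weight.\<close>
  define I where "I = {w \<in> W. z \<in> G w}"
  define c where "c w = \<beta> w z / s z" for w
  have I: "finite I" "I \<subseteq> W" using W by (auto simp: I_def)
  have c0: "c w = 0" if "w \<in> W - I" for w using that \<beta>_eq0[OF z(1)] by (auto simp: I_def c_def)
  have cpos: "0 < c w" if "w \<in> I" for w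
    using that \<beta>_eq0[OF z(1), of w] \<beta>0[of w z] s[OF z(1)] by (simp add: I_def c_def)
  have c1: "sum c I = 1"
    using s1[OF z(1), folded c_def] sum.mono_neutral_right[OF W(2) I(2), of c] c0 by simp
  have bary: "(\<Sum>w\<in>I. c w *\<^sub>R w) = z"
    using z(2)[unfolded T_def, folded c_def] sum.mono_neutral_right[OF W(2) I(2), of "\<lambda>w. c w *\<^sub>R w"] c0
    by simp
  \<comment> \<open>Jensen at the fixed point, whose projection is the barycentre, makes the
    weighted sum of \<open>f z w\<close> nonnegative: the terms with \<open>p\<close>
    cancel.\<close>
  have "u \<eta> \<le> (\<Sum>w\<in>I. c w * u (hlift \<eta> w))"
    using I c1 bary cpos eta
    by (intro jensen_center[OF op cv continuous_on_subset[OF cont closure_subset] hc])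
      (auto simp: I_def G_def \<eta>_def less_imp_le)
  moreover have "(\<Sum>w\<in>I. c w * f z w) < (\<Sum>w\<in>I. 0)"
  proof (rule sum_strict_mono)
    show "I \<noteq> {}" using c1 by auto
    show "c w * f z w < 0" if "w \<in> I" for w
      using cpos[OF that] that by (auto simp: I_def G_def mult_pos_neg)
  qed (rule I)
  moreover have "(\<Sum>w\<in>I. c w * f z w) = (\<Sum>w\<in>I. c w * u (hlift \<eta> w)) - u \<eta>"
  proof -
    have "(\<Sum>w\<in>I. c w * (p \<bullet> (w - z))) = p \<bullet> ((\<Sum>w\<in>I. c w *\<^sub>R w) - (\<Sum>w\<in>I. c w *\<^sub>R z))"
      by (simp add: inner_sum_right inner_diff_right right_diff_distrib sum_subtractf)
    also have "\<dots> = 0" by (simp add: bary c1 flip: scaleR_sum_left)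
    finally have "(\<Sum>w\<in>I. c w * (p \<bullet> (w - z))) = 0" .
    moreover have "(\<Sum>w\<in>I. c w * u \<eta>) = u \<eta>" by (simp add: c1 flip: sum_distrib_right)
    ultimately show ?thesis
      unfolding f_def \<eta>_def[symmetric] by (simp add: right_diff_distrib sum_subtractf)
  qed
  ultimately show False by simp
qed

section \<open>Gauge distance and slice estimates\<close>

lemma hgauge_power4: "hgauge p ^ 4 = norm (Pr1 p) ^ 4 + ht p ^ 2"
proof -
  have sq: "norm (Pr1 p) ^ 2 = norm (hx p) ^ 2 + norm (hy p) ^ 2"
    by (simp add: Pr1_def norm_prod_def)
  have "(S powr (1/4)) ^ 4 = S" if "0 \<le> S" for S :: real
    using that by (cases "S = 0") (simp_all add: powr_power)
  then have "hgauge p ^ 4 = (norm (hx p) ^ 2 + norm (hy p) ^ 2) ^ 2 + (ht p) ^ 2"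
    unfolding hgauge_def by simp
  also have "(norm (hx p) ^ 2 + norm (hy p) ^ 2) ^ 2 = norm (Pr1 p) ^ 4"
    unfolding sq[symmetric] by (simp flip: power_mult)
  finally show ?thesis .
qed

lemma hgauge_nonneg: "0 \<le> hgauge p"
  by (simp add: hgauge_def)

lemma norm_Pr1_le_hgauge: "norm (Pr1 p) \<le> hgauge p"
proof (rule power_le_imp_le_base[of _ 3])
  show "norm (Pr1 p) ^ Suc 3 \<le> hgauge p ^ Suc 3"
    using hgauge_power4[of p] by simp
qed (rule hgauge_nonneg)

lemma abs_ht_le_hgauge: "\<bar>ht p\<bar> \<le> hgauge p ^ 2"
proof (rule power_le_imp_le_base[of _ 1])
  have "\<bar>ht p\<bar> ^ 2 \<le> hgauge p ^ 4"
    using hgauge_power4[of p] by simp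
  then show "\<bar>ht p\<bar> ^ Suc 1 \<le> (hgauge p ^ 2) ^ Suc 1"
    by (simp flip: power_mult power2_eq_square)
qed simp

lemma dH_nonneg: "0 \<le> dH p q"
  by (simp add: dH_def hgauge_nonneg)

lemma Pr1_hinv_hmult: "Pr1 (hinv q \<circ>\<^sub>H p) = Pr1 p - Pr1 q"
  by (simp add: heis_defs hmult_def hinv_def)

lemma ht_hinv_hmult: "ht (hinv q \<circ>\<^sub>H p) = ht p - ht q + 2 * hsymp (Pr1 q) (Pr1 p)"
  by (simp add: heis_defs hmult_def hinv_def inner_commute)

lemma norm_Pr1_diff_le_dH: "norm (Pr1 p - Pr1 q) \<le> dH p q"
  unfolding dH_def using norm_Pr1_le_hgauge[of "hinv q \<circ>\<^sub>H p"] by (simp add: Pr1_hinv_hmult)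

text \<open>The anisotropy of the gauge: the vertical offset from the plane at \<open>p\<close> is
  of second order in the distance.\<close>

lemma heis_vert_decomp:
  obtains t where "q = hlift p (Pr1 q) + vert t" "\<bar>t\<bar> \<le> dH p q ^ 2"
proof
  show "q = hlift p (Pr1 q) + vert (- ht (hinv q \<circ>\<^sub>H p))"
    by (simp add: heis_eq_iff ht_hinv_hmult)
  show "\<bar>- ht (hinv q \<circ>\<^sub>H p)\<bar> \<le> dH p q ^ 2"
    using abs_ht_le_hgauge[of "hinv q \<circ>\<^sub>H p"] by (simp add: dH_def)
qed

text \<open>Horizontal displacement and vertical offset are continuous coordinates around
  \<open>p\<close>, and both are small when \<open>dH p q\<close> is.\<close>

lemma dH_compl_open_bounded_below:
  assumes op: "open \<Omega>" and p: "p \<in> \<Omega>"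
  obtains \<delta> where "0 < \<delta>" "\<And>q. q \<notin> \<Omega> \<Longrightarrow> \<delta> \<le> dH p q"
proof -
  define F where "F x = hlift p (Pr1 p + fst x) + vert (snd x)" for x
  have "continuous_on UNIV F"
    unfolding F_def by (intro continuous_intros)
  then have "open (F -` \<Omega>)"
    by (rule open_vimage[OF op])
  moreover have "0 \<in> F -` \<Omega>" using p by (simp add: F_def)
  ultimately obtain e where e: "0 < e" "ball 0 e \<subseteq> F -` \<Omega>"
    using open_contains_ball by blast
  \<comment> \<open>The bound 1 ensures that the squared distance is at most the distance.\<close>
  define \<delta> where "\<delta> = min 1 (e / 2)"
  have "\<delta> \<le> dH p q" if "q \<notin> \<Omega>" for q
  proof (rule ccontr)
    assume "\<not> \<delta> \<le> dH p q"
    then have d: "dH p q < 1" "2 * dH p q < e" by (auto simp: \<delta>_def)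
    obtain t where t: "q = hlift p (Pr1 q) + vert t" "\<bar>t\<bar> \<le> dH p q ^ 2"
      by (rule heis_vert_decomp)
    have "F (Pr1 q - Pr1 p, t) = q" using t(1) by (simp add: F_def)
    moreover have "norm (Pr1 q - Pr1 p, t) < e"
    proof -
      have "norm (Pr1 q - Pr1 p, t) \<le> norm (Pr1 q - Pr1 p) + \<bar>t\<bar>"
        by (rule order_trans[OF norm_Pair_le]) simp
      also have "\<dots> \<le> dH p q + dH p q"
      proof (rule add_mono)
        show "norm (Pr1 q - Pr1 p) \<le> dH p q"
          using norm_Pr1_diff_le_dH[of p q] by (simp add: norm_minus_commute)
        have "dH p q ^ 2 \<le> dH p q"
          using d(1) dH_nonneg[of p q] by (simp add: power2_eq_square mult_left_le)
        then show "\<bar>t\<bar> \<le> dH p q" using t(2) by linarith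
      qed
      finally show ?thesis using d(2) by simp
    qed
    then have "F (Pr1 q - Pr1 p, t) \<in> \<Omega>" using e(2) by (metis mem_ball_0 subsetD vimageD)
    ultimately show False using that by simp
  qed
  then show thesis using that[of \<delta>] e by (auto simp: \<delta>_def)
qed

section \<open>Size of slices, exits through the boundary and the sign of u\<close>

text \<open>Horizontal boundedness supplies the upper bounds that both nested real suprema
  require.\<close>

lemma norm_hslice_le_diamHS:
  assumes hb: "horiz_bounded \<Omega>" and p: "p \<in> \<Omega>" and z: "z \<in> hslice \<Omega> p"
  shows "norm (z - Pr1 p) \<le> diamHS \<Omega>"
proof -
  obtain M where M: "\<And>p a b. p \<in> \<Omega> \<Longrightarrow> a \<in> \<Omega> \<inter> hplane p \<Longrightarrow> b \<in> \<Omega> \<inter> hplane p \<Longrightarrow> dH a b \<le> M"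
    using hb unfolding horiz_bounded_def by blast
  have self: "q \<in> hplane q" for q :: "'a heis" by (simp add: mem_hplane_iff)
  have "diamH (\<Omega> \<inter> hplane q) \<le> M" if "q \<in> \<Omega>" for q
    unfolding diamH_def
  proof (rule cSUP_least)
    show "(\<Omega> \<inter> hplane q) \<times> (\<Omega> \<inter> hplane q) \<noteq> {}" using self[of q] that by blast
  qed (use M[OF that] in auto)
  then have bd: "bdd_above ((\<lambda>q. diamH (\<Omega> \<inter> hplane q)) ` \<Omega>)" by (auto intro!: bdd_aboveI)
  have in2: "(hlift p z, p) \<in> (\<Omega> \<inter> hplane p) \<times> (\<Omega> \<inter> hplane p)"
    using p z self by (simp add: mem_hslice hplane_eq_range)
  have "norm (z - Pr1 p) \<le> dH (hlift p z) p"
    using norm_Pr1_diff_le_dH[of "hlift p z" p] by simp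
  also have "\<dots> \<le> diamH (\<Omega> \<inter> hplane p)"
    unfolding diamH_def
  proof (rule cSUP_upper2[OF _ in2])
    show "bdd_above ((\<lambda>pq. dH (fst pq) (snd pq)) ` ((\<Omega> \<inter> hplane p) \<times> (\<Omega> \<inter> hplane p)))"
      by (rule bdd_aboveI2[where M = M]) (use M[OF p] in auto)
  qed simp
  also have "\<dots> \<le> diamHS \<Omega>"
    unfolding diamHS_def by (rule cSUP_upper[OF p bd])
  finally show ?thesis .
qed

lemma bounded_hslice:
  assumes "horiz_bounded \<Omega>" "p \<in> \<Omega>"
  shows "bounded (hslice \<Omega> p)"
  using norm_hslice_le_diamHS[OF assms] unfolding bounded_def
  by (metis dist_norm norm_minus_commute)

lemma diamHS_pos:
  assumes "open \<Omega>" "horiz_bounded \<Omega>" "p \<in> \<Omega>"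
  shows "0 < diamHS \<Omega>"
proof -
  obtain e where e: "0 < e" "cball (Pr1 p) e \<subseteq> hslice \<Omega> p"
    using open_contains_cball open_hslice[OF assms(1)] Pr1_mem_hslice[OF assms(3)] by blast
  obtain v :: "(real^'a) \<times> (real^'a)" where v: "norm v = e"
    using vector_choose_size[of e] less_imp_le[OF e(1)] by metis
  have "Pr1 p + v \<in> hslice \<Omega> p" using e v by (intro subsetD[OF e(2)]) (simp add: dist_norm)
  from norm_hslice_le_diamHS[OF assms(2,3) this] show ?thesis using v e by simp
qed

lemma hslice_exit:
  assumes op: "open \<Omega>" and hb: "horiz_bounded \<Omega>" and p: "p \<in> \<Omega>" and v: "v \<noteq> 0"
  obtains s where "0 < s" "hlift p (Pr1 p + s *\<^sub>R v) \<in> frontier \<Omega>"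
proof -
  \<comment> \<open>One unit beyond the slicing diameter, so the end point must be outside.\<close>
  define S where "S = (diamHS \<Omega> + 1) / norm v"
  have S: "0 < S" "norm (S *\<^sub>R v) = diamHS \<Omega> + 1"
    using diamHS_pos[OF op hb p] v by (auto simp: S_def)
  define Q where "Q = hlift p (Pr1 p + S *\<^sub>R v)"
  have "Q \<notin> \<Omega>"
  proof
    assume "Q \<in> \<Omega>"
    then have "norm (Pr1 p + S *\<^sub>R v - Pr1 p) \<le> diamHS \<Omega>"
      by (intro norm_hslice_le_diamHS[OF hb p]) (simp add: mem_hslice Q_def)
    then show False using S(2) by simp
  qed
  then have "closed_segment p Q \<inter> frontier \<Omega> \<noteq> {}"
    using p by (intro connected_Int_frontier connected_segment) auto
  then obtain q t where q: "q \<in> frontier \<Omega>" "q = (1 - t) *\<^sub>R p + t *\<^sub>R Q" "0 \<le> t" "t \<le> 1"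
    by (auto simp: in_segment)
  have "t \<noteq> 0" using q op p by (auto simp: frontier_def interior_open)
  have "Pr1 p + (t * S) *\<^sub>R v = (1 - t) *\<^sub>R Pr1 p + t *\<^sub>R (Pr1 p + S *\<^sub>R v)"
    by (simp add: algebra_simps)
  then have "hlift p (Pr1 p + (t * S) *\<^sub>R v) = q"
    by (simp add: hlift_convex_comb q(2) Q_def)
  then show thesis using that[of "t * S"] q S \<open>t \<noteq> 0\<close> by auto
qed

text \<open>A horizontal line through \<open>p\<close> leaves the domain on both sides. The two exit
  points are horizontally related, because parallel displacements have zero symplectic product, and
  \<open>u\<close> vanishes at both.\<close>

lemma hconvex_nonpos:
  fixes \<Omega> :: "'n::finite heis set"
  assumes op: "open \<Omega>" and hb: "horiz_bounded \<Omega>" and hc: "hconvex_fun (closure \<Omega>) u"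
    and zero: "\<And>p. p \<in> frontier \<Omega> \<Longrightarrow> u p = 0" and p: "p \<in> \<Omega>"
  shows "u p \<le> 0"
proof -
  obtain v :: "(real^'n) \<times> (real^'n)" where "norm v = 1"
    using vector_choose_size[of 1] zero_le_one by metis
  then have v: "v \<noteq> 0" by auto
  obtain s where s: "0 < s" "hlift p (Pr1 p + s *\<^sub>R v) \<in> frontier \<Omega>"
    using hslice_exit[OF op hb p v] .
  obtain t where t: "0 < t" "hlift p (Pr1 p + t *\<^sub>R (- v)) \<in> frontier \<Omega>"
    using hslice_exit[OF op hb p, of "- v"] v by auto
  define P where "P = hlift p (Pr1 p + s *\<^sub>R v)"
  define Q where "Q = hlift p (Pr1 p + t *\<^sub>R (- v))"
  have "hsymp (t *\<^sub>R (- v)) (s *\<^sub>R v) = 0"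
    by (simp only: hsymp_scaleR_left hsymp_scaleR_right) (simp add: hsymp_def inner_commute)
  then have "Q = hlift P (Pr1 p + t *\<^sub>R (- v))"
    unfolding P_def Q_def hlift_hlift by (simp only: add_diff_cancel_left') simp
  then have QP: "Q \<in> hplane P" by (simp add: hplane_eq_range)
  define l where "l = s / (s + t)"
  have l: "0 \<le> l" "l \<le> 1" "(1 - l) * s = l * t" using s t by (auto simp: l_def field_simps)
  have "(1 - l) *\<^sub>R (Pr1 p + s *\<^sub>R v) + l *\<^sub>R (Pr1 p + t *\<^sub>R (- v)) = Pr1 p + ((1 - l) * s - l * t) *\<^sub>R v"
    by (simp add: algebra_simps)
  also have "\<dots> = Pr1 p" using l by simp
  finally have "p = (1 - l) *\<^sub>R P + l *\<^sub>R Q"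
    unfolding P_def Q_def hlift_convex_comb[symmetric] by (simp only: hlift_Pr1)
  then have "u p \<le> (1 - l) * u P + l * u Q"
    using hconvex_funD[OF hc _ _ QP l(1,2)] s t by (auto simp: P_def Q_def frontier_def)
  then show ?thesis using zero s t by (simp add: P_def Q_def)
qed

section \<open>Lower bounds for outer measure\<close>

lemma leb_outer_lower:
  assumes "S \<in> sets lebesgue" "S \<subseteq> A"
  shows "emeasure lebesgue S \<le> leb_outer A"
  unfolding leb_outer_def using assms by (intro INF_greatest emeasure_mono) blast+

lemma leb_outer_hsubdiff_le_LHS:
  "p \<in> \<Omega> \<Longrightarrow> leb_outer (hsubdiff_set \<Omega> u (\<Omega> \<inter> hplane p)) \<le> LHS_measure \<Omega> u"
  unfolding LHS_measure_def by (rule SUP_upper)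

lemma leb_outer_capsule:
  fixes A :: "((real^'n::finite) \<times> (real^'n)) set"
  assumes e: "norm e = 1" and r: "0 < r" and L: "0 \<le> L"
    and A: "\<And>\<tau>. 0 \<le> \<tau> \<Longrightarrow> \<tau> \<le> L \<Longrightarrow> ball (\<tau> *\<^sub>R e) r \<subseteq> A"
  shows "ennreal (L / 2 * unit_ball_vol (real (2 * CARD('n))) * r ^ (2 * CARD('n) - 1)) \<le> leb_outer A"
proof -
  \<comment> \<open>Pack disjoint balls of radius r along the segment; this avoids rotating e to a coordinate axis.\<close>
  define N where "N = nat \<lfloor>L / (2 * r)\<rfloor>"
  have Lr: "0 \<le> L / (2 * r)" using L r by simp
  have N: "real N \<le> L / (2 * r)" "L / (2 * r) \<le> real N + 1"
    using Lr by (auto simp: N_def)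
  define B where "B j = ball ((2 * r * real j) *\<^sub>R e) r" for j :: nat
  have BA: "B j \<subseteq> A" if "j \<le> N" for j
    unfolding B_def
  proof (rule A)
    have "real j \<le> L / (2 * r)" using that N(1) by simp
    then show "2 * r * real j \<le> L" using r by (simp add: field_simps)
  qed (use r in simp)
  have disj: "disjoint_family_on B {..N}"
    unfolding disjoint_family_on_def
  proof (intro ballI impI)
    fix i j :: nat assume "i \<noteq> j"
    then have "1 \<le> \<bar>real i - real j\<bar>" by linarith
    then have "2 * r \<le> 2 * r * \<bar>real i - real j\<bar>" using r by simp
    also have "\<dots> = norm (((2 * r) * (real i - real j)) *\<^sub>R e)"
      using e r by (simp add: abs_mult)
    also have "\<dots> = dist ((2 * r * real i) *\<^sub>R e) ((2 * r * real j) *\<^sub>R e)"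
      by (simp add: dist_norm right_diff_distrib flip: scaleR_diff_left)
    finally show "B i \<inter> B j = {}"
      unfolding B_def using r by (intro disjoint_ballI) auto
  qed
  define n where "n = CARD('n)"
  have n: "0 < n" by (simp add: n_def)
  define \<omega> where "\<omega> = unit_ball_vol (real (2 * n))"
  have \<omega>: "0 \<le> \<omega>" by (simp add: \<omega>_def)
  have em: "emeasure lebesgue (B j) = ennreal (\<omega> * r ^ (2 * n))" for j
  proof -
    have dim: "DIM((real^'n) \<times> (real^'n)) = 2 * n" by (simp add: n_def)
    have "emeasure lebesgue (B j) = emeasure lborel (B j)" by (simp add: B_def)
    also have "\<dots> = ennreal (\<omega> * r ^ (2 * n))"
      unfolding B_def \<omega>_def using emeasure_ball[of r "(2 * r * real j) *\<^sub>R e", unfolded dim] r by simp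
    finally show ?thesis .
  qed
  \<comment> \<open>The indices 0 to \<open>N\<close> give N + 1 balls, at least L/(2r) of
    them.\<close>
  have "L / 2 * \<omega> * r ^ (2 * n - 1) = L / (2 * r) * (\<omega> * r ^ (2 * n))"
    using r n by (simp add: power_eq_if)
  also have "\<dots> \<le> real (N + 1) * (\<omega> * r ^ (2 * n))"
    using N(2) \<omega> r by (intro mult_right_mono) auto
  finally have "ennreal (L / 2 * \<omega> * r ^ (2 * n - 1)) \<le> ennreal (real (N + 1) * (\<omega> * r ^ (2 * n)))"
    by (rule ennreal_leI)
  also have "\<dots> = (\<Sum>j\<le>N. emeasure lebesgue (B j))"
    unfolding em using \<omega> r by (simp add: ennreal_mult ennreal_of_nat_eq_real_of_nat)
  also have "\<dots> = emeasure lebesgue (\<Union>j\<le>N. B j)"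
    by (rule sum_emeasure[OF _ disj]) (auto simp: B_def)
  also have "\<dots> \<le> leb_outer A"
    using BA by (intro leb_outer_lower) (auto simp: B_def)
  finally show ?thesis by (simp add: \<omega>_def n_def)
qed

section \<open>The estimate on one horizontal slice\<close>

text \<open>Slopes along the slab normal are limited only by \<open>H\<close>, all others by the
  slicing diameter, so a long thin capsule of slopes satisfies the hypothesis of
  \<open>hsubdiff_covers\<close>.\<close>

proposition aleksandrov_slice:
  fixes \<Omega> :: "'n::finite heis set"
  assumes op: "open \<Omega>" and cv: "convex \<Omega>" and hb: "horiz_bounded \<Omega>"
    and cont: "continuous_on (closure \<Omega>) u" and hc: "hconvex_fun (closure \<Omega>) u"
    and zero: "\<And>p. p \<in> frontier \<Omega> \<Longrightarrow> u p = 0" and p: "p \<in> \<Omega>"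
    and g: "g \<noteq> 0" and H: "0 < H"
    and slab: "\<And>z. z \<in> hslice \<Omega> p \<Longrightarrow> g \<bullet> (z - Pr1 p) \<le> norm g * H"
  shows "ennreal (\<bar>u p\<bar> ^ (2 * CARD('n))) \<le>
    ennreal (2 ^ (2 * CARD('n) + 1) / unit_ball_vol (real (2 * CARD('n))) * H * diamHS \<Omega> ^ (2 * CARD('n) - 1))
      * LHS_measure \<Omega> u"
proof (cases "u p = 0")
  case True
  then show ?thesis by (simp add: power_0_left)
next
  case False
  define m where "m = - u p"
  have "u p \<le> 0" by (rule hconvex_nonpos[OF op hb hc zero p])
  with False have m: "0 < m" "\<bar>u p\<bar> = m" by (auto simp: m_def)
  define R where "R = diamHS \<Omega>"
  have R: "0 < R" unfolding R_def by (rule diamHS_pos[OF op hb p])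
  define e where "e = g /\<^sub>R norm g"
  have e: "norm e = 1" using g by (simp add: e_def)
  \<comment> \<open>Half of \<open>m\<close> is spent on the slope along \<open>e\<close>, half on
    the deviation from it.\<close>
  define r where "r = m / (2 * R)"
  define L where "L = m / (2 * H)"
  have rL: "0 < r" "0 \<le> L" using m R H by (auto simp: r_def L_def)
  have ez: "e \<bullet> (z - Pr1 p) \<le> H" if "z \<in> hslice \<Omega> p" for z
    using slab[OF that] g by (simp add: e_def field_simps)
  have cl: "norm (z - Pr1 p) \<le> R \<and> e \<bullet> (z - Pr1 p) \<le> H" if "z \<in> closure (hslice \<Omega> p)" for z
  proof -
    have "closed {z. norm (z - Pr1 p) \<le> R \<and> e \<bullet> (z - Pr1 p) \<le> H}"
      by (intro closed_Collect_conj closed_Collect_le continuous_intros)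
    moreover have "hslice \<Omega> p \<subseteq> {z. norm (z - Pr1 p) \<le> R \<and> e \<bullet> (z - Pr1 p) \<le> H}"
      using ez norm_hslice_le_diamHS[OF hb p] by (auto simp: R_def)
    ultimately show ?thesis using closure_minimal that by blast
  qed
  have "ball (\<tau> *\<^sub>R e) r \<subseteq> hsubdiff_set \<Omega> u (\<Omega> \<inter> hplane p)" if \<tau>: "0 \<le> \<tau>" "\<tau> \<le> L" for \<tau>
  proof
    fix x assume "x \<in> ball (\<tau> *\<^sub>R e) r"
    then have q: "norm (x - \<tau> *\<^sub>R e) < r" by (simp add: dist_norm norm_minus_commute)
    show "x \<in> hsubdiff_set \<Omega> u (\<Omega> \<inter> hplane p)"
    proof (rule hsubdiff_covers[OF op cv cont _ zero p])
      show "hconvex_fun \<Omega> u" using hc closure_subset by (rule hconvex_fun_subset)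
      show "bounded (hslice \<Omega> p)" by (rule bounded_hslice[OF hb p])
      fix z assume z: "z \<in> closure (hslice \<Omega> p)"
      have "x \<bullet> (z - Pr1 p) = \<tau> * (e \<bullet> (z - Pr1 p)) + (x - \<tau> *\<^sub>R e) \<bullet> (z - Pr1 p)"
        by (simp add: inner_diff_left)
      also have "\<tau> * (e \<bullet> (z - Pr1 p)) \<le> \<tau> * H"
        using cl[OF z] \<tau> by (intro mult_left_mono) auto
      also have "\<tau> * H \<le> L * H" using \<tau> H by simp
      also have "L * H = m / 2" using H by (simp add: L_def)
      also have "(x - \<tau> *\<^sub>R e) \<bullet> (z - Pr1 p) \<le> norm (x - \<tau> *\<^sub>R e) * norm (z - Pr1 p)"
        by (rule norm_cauchy_schwarz)
      also have "\<dots> \<le> norm (x - \<tau> *\<^sub>R e) * R"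
        using cl[OF z] by (intro mult_left_mono) auto
      also have "\<dots> < r * R" using q R by simp
      also have "r * R = m / 2" using R by (simp add: r_def)
      finally show "x \<bullet> (z - Pr1 p) < - u p" by (simp add: m_def)
    qed
  qed
  from leb_outer_capsule[OF e rL this] have
    "ennreal (L / 2 * unit_ball_vol (real (2 * CARD('n))) * r ^ (2 * CARD('n) - 1)) \<le> LHS_measure \<Omega> u"
    using leb_outer_hsubdiff_le_LHS[OF p] order_trans by blast
  define n where "n = CARD('n)"
  have n: "0 < n" by (simp add: n_def)
  define \<omega> where "\<omega> = unit_ball_vol (real (2 * n))"
  have \<omega>: "0 < \<omega>" by (simp add: \<omega>_def)
  \<comment> \<open>The factors 4 H from the length term and (2R)^(2n-1) from the radius combine to
    this constant.\<close>
  define c where "c = 2 ^ (2 * n + 1) / \<omega> * H * R ^ (2 * n - 1)"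
  have c: "0 \<le> c" using \<omega> H R by (simp add: c_def)
  obtain k where k: "2 * n = Suc k" using n by (cases "2 * n") auto
  have "c * (L / 2 * \<omega> * r ^ (2 * n - 1)) = m ^ (2 * n)"
    using \<omega> H R unfolding c_def L_def r_def k by (simp add: field_simps power_mult_distrib)
  then have "ennreal (m ^ (2 * n)) = ennreal c * ennreal (L / 2 * \<omega> * r ^ (2 * n - 1))"
    using c by (simp flip: ennreal_mult')
  also have "\<dots> \<le> ennreal c * LHS_measure \<Omega> u"
    using \<open>_ \<le> LHS_measure \<Omega> u\<close> by (intro mult_left_mono) (auto simp: \<omega>_def n_def)
  finally show ?thesis by (simp add: m(2) c_def \<omega>_def n_def R_def)
qed

section \<open>From slabs to the distance of a boundary point\<close>

lemma aleksandrov_frontier_point: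
  fixes \<Omega> :: "'n::finite heis set"
  assumes op: "open \<Omega>" and cv: "convex \<Omega>" and hb: "horiz_bounded \<Omega>"
    and cont: "continuous_on (closure \<Omega>) u" and hc: "hconvex_fun (closure \<Omega>) u"
    and zero: "\<And>p. p \<in> frontier \<Omega> \<Longrightarrow> u p = 0" and p: "p \<in> \<Omega>" and q: "q \<in> frontier \<Omega>"
  shows "ennreal (\<bar>u p\<bar> ^ (2 * CARD('n))) \<le>
    ennreal (2 ^ (4 * CARD('n) + 3) / unit_ball_vol (real (2 * CARD('n))) * dH p q * diamHS \<Omega> ^ (2 * CARD('n) - 1))
      * LHS_measure \<Omega> u"
proof -
  define n where "n = CARD('n)"
  define d where "d = dH p q"
  define R where "R = diamHS \<Omega>"
  have R: "0 < R" unfolding R_def by (rule diamHS_pos[OF op hb p])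
  define C where "C = 2 ^ (2 * n + 1) / unit_ball_vol (real (2 * n)) * (4 * d) * R ^ (2 * n - 1)"
  have q_notin: "q \<notin> \<Omega>" using q op by (simp add: frontier_def interior_open)
  have d: "0 < d"
    using dH_compl_open_bounded_below[OF op p] q_notin unfolding d_def by (metis less_le_trans)
  have C: "0 \<le> C" using d R by (simp add: C_def)
  \<comment> \<open>The slab width 4d contributes 4, and the loss of half of |u| contributes
    2^(2n).\<close>
  have four: "2 ^ (4 * n + 3) / unit_ball_vol (real (2 * n)) * d * R ^ (2 * n - 1) = 2 ^ (2 * n) * C"
  proof -
    have "(2::real) ^ (4 * n + 3) = 2 ^ (2 * n) * 2 ^ (2 * n + 1) * 4"
      by (simp add: power_add power_mult flip: power_mult_distrib)
    then show ?thesis by (simp add: C_def)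
  qed
  have main: "ennreal (\<bar>u \<eta>\<bar> ^ (2 * n)) \<le> ennreal C * LHS_measure \<Omega> u"
    if "\<eta> \<in> \<Omega>" "g \<noteq> 0" "\<And>z. z \<in> hslice \<Omega> \<eta> \<Longrightarrow> g \<bullet> (z - Pr1 \<eta>) \<le> norm g * (4 * d)" for \<eta> g
    using aleksandrov_slice[OF op cv hb cont hc zero that(1,2) _ that(3)] d
    by (simp add: C_def n_def R_def)
  \<comment> \<open>Each case below only has to produce a base point \<open>\<eta>\<close> and a
    slab of width 4d for its slice.\<close>
  have finish: ?thesis if "\<eta> \<in> \<Omega>" "g \<noteq> 0" "\<bar>u p\<bar> \<le> 2 * \<bar>u \<eta>\<bar>"
    "\<And>z. z \<in> hslice \<Omega> \<eta> \<Longrightarrow> g \<bullet> (z - Pr1 \<eta>) \<le> norm g * (4 * d)" for \<eta> g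
  proof -
    have "\<bar>u p\<bar> ^ (2 * n) \<le> 2 ^ (2 * n) * \<bar>u \<eta>\<bar> ^ (2 * n)"
      using power_mono[OF that(3), of "2 * n"] by (simp add: power_mult_distrib)
    then have "ennreal (\<bar>u p\<bar> ^ (2 * n)) \<le> ennreal (2 ^ (2 * n)) * ennreal (\<bar>u \<eta>\<bar> ^ (2 * n))"
      by (simp add: ennreal_leI flip: ennreal_mult')
    also have "\<dots> \<le> ennreal (2 ^ (2 * n)) * (ennreal C * LHS_measure \<Omega> u)"
      using main[OF that(1,2,4)] by (intro mult_left_mono) auto
    also have "\<dots> = ennreal (2 ^ (2 * n) * C) * LHS_measure \<Omega> u"
      using C by (simp add: ennreal_mult' mult.assoc)
    finally show ?thesis
      unfolding four[symmetric] by (simp add: n_def d_def R_def)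
  qed
  have "\<exists>a b. a \<noteq> 0 \<and> (\<forall>x\<in>{q}. a \<bullet> x \<le> b) \<and> (\<forall>x\<in>\<Omega>. b \<le> a \<bullet> x)"
    using cv p q_notin by (intro separating_hyperplane_sets) auto
  then obtain N b0 where N: "N \<noteq> 0" "N \<bullet> q \<le> b0" "\<And>x. x \<in> \<Omega> \<Longrightarrow> b0 \<le> N \<bullet> x"
    by blast
  \<comment> \<open>The sign change makes (A, -ht N) an outward normal.\<close>
  define A where "A = - Pr1 N"
  define b where "b = - ht N"
  have supp: "A \<bullet> Pr1 x + b * ht x \<le> A \<bullet> Pr1 q + b * ht q" if "x \<in> \<Omega>" for x
    using N(2) N(3)[OF that] by (simp add: inner_heis A_def b_def)
  have nz: "A \<noteq> 0 \<or> b \<noteq> 0"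
    using N(1) heis_eq_iff[of N 0] by (auto simp: A_def b_def heis_defs zero_prod_def)
  \<comment> \<open>Inserting the height of a lift into the supporting inequality gives a half-space
    in the slice whose normal varies affinely with \<open>Pr1 \<eta>\<close>.\<close>
  have slice: "(A + (2 * b) *\<^sub>R Jrot (Pr1 \<eta>)) \<bullet> (z - Pr1 \<eta>) \<le> A \<bullet> (Pr1 q - Pr1 \<eta>) + b * (ht q - ht \<eta>)"
    if "z \<in> hslice \<Omega> \<eta>" for z \<eta>
  proof -
    have "A \<bullet> z + b * (ht \<eta> + 2 * hsymp (z - Pr1 \<eta>) (Pr1 \<eta>)) \<le> A \<bullet> Pr1 q + b * ht q"
      using supp[of "hlift \<eta> z"] that by (simp add: mem_hslice hsymp_diff_left)
    then show ?thesis
      unfolding hsymp_eq_inner by (simp add: inner_add_left inner_diff_right inner_commute algebra_simps)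
  qed
  obtain t where t: "q = hlift p (Pr1 q) + vert t" "\<bar>t\<bar> \<le> d ^ 2"
    unfolding d_def by (rule heis_vert_decomp)
  have htq: "ht q = ht p + 2 * hsymp (Pr1 q) (Pr1 p) + t"
    using arg_cong[OF t(1), of ht] by simp
  have nq: "norm (Pr1 q - Pr1 p) \<le> d"
    using norm_Pr1_diff_le_dH[of p q] by (simp add: d_def norm_minus_commute)
  define g0 where "g0 = A + (2 * b) *\<^sub>R Jrot (Pr1 p)"
  define h0 where "h0 = A \<bullet> (Pr1 q - Pr1 p) + b * (ht q - ht p)"
  have "h0 = g0 \<bullet> (Pr1 q - Pr1 p) + b * t"
  proof -
    have "hsymp (Pr1 q) (Pr1 p) = hsymp (Pr1 q - Pr1 p) (Pr1 p)" by (simp add: hsymp_diff_left)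
    then show ?thesis
      unfolding h0_def g0_def htq hsymp_eq_inner by (simp add: inner_add_left inner_commute algebra_simps)
  qed
  also have "g0 \<bullet> (Pr1 q - Pr1 p) \<le> norm g0 * norm (Pr1 q - Pr1 p)"
    by (rule norm_cauchy_schwarz)
  also have "norm g0 * norm (Pr1 q - Pr1 p) \<le> norm g0 * d"
    using nq by (intro mult_left_mono) auto
  also have "b * t \<le> \<bar>b\<bar> * d ^ 2"
    using mult_left_mono[OF t(2), of "\<bar>b\<bar>"] abs_ge_self[of "b * t"] by (simp add: abs_mult)
  finally have h0: "h0 \<le> norm g0 * d + (\<bar>b\<bar> * d) * d" by (simp add: power2_eq_square)
  show ?thesis
  \<comment> \<open>In the first case the trace lies within 2d of \<open>p\<close>. Otherwise the
    supporting hyperplane is nearly parallel to the plane at \<open>p\<close>, and the base point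
    has to move.\<close>
  proof (cases "\<bar>b\<bar> * d \<le> norm g0")
    case True
    have g0_nz: "g0 \<noteq> 0"
    proof
      assume "g0 = 0"
      then have "b = 0" using True d by (auto simp: mult_le_0_iff)
      then show False using nz \<open>g0 = 0\<close> by (simp add: g0_def)
    qed
    have "(\<bar>b\<bar> * d) * d \<le> norm g0 * d"
      using True d by (intro mult_right_mono) auto
    then have "h0 \<le> norm g0 * d + norm g0 * d"
      using h0 by linarith
    also have "\<dots> \<le> norm g0 * (4 * d)"
      using d mult_nonneg_nonneg[of "norm g0" d] by (simp add: algebra_simps)
    finally have "h0 \<le> norm g0 * (4 * d)" .
    with g0_nz show ?thesis
      using slice[of _ p] unfolding g0_def[symmetric] h0_def[symmetric]
      by (intro finish[OF p, of g0]) (auto intro: order_trans)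
  next
    case False
    then have lt: "norm g0 < \<bar>b\<bar> * d" by simp
    obtain v :: "(real^'n) \<times> (real^'n)" where v: "norm v = 2 * d"
      using vector_choose_size[of "2 * d"] d by (metis less_imp_le mult_pos_pos zero_less_numeral)
    show ?thesis
    proof (cases "hlift p (Pr1 p + 2 *\<^sub>R v) \<in> \<Omega>")
      case outside: False
      \<comment> \<open>The convex slice misses a point at distance 4d, so separating that point
        gives the slab at \<open>p\<close> itself.\<close>
      have "\<exists>a b. a \<noteq> 0 \<and> (\<forall>x\<in>{Pr1 p + 2 *\<^sub>R v}. a \<bullet> x \<le> b) \<and> (\<forall>x\<in>hslice \<Omega> p. b \<le> a \<bullet> x)"
      proof (rule separating_hyperplane_sets)
        show "hslice \<Omega> p \<noteq> {}" using Pr1_mem_hslice[OF p] by blast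
        show "{Pr1 p + 2 *\<^sub>R v} \<inter> hslice \<Omega> p = {}" using outside by (simp add: mem_hslice)
      qed (use convex_hslice[OF cv] in auto)
      then obtain m c where m: "m \<noteq> 0" "m \<bullet> (Pr1 p + 2 *\<^sub>R v) \<le> c" "\<And>z. z \<in> hslice \<Omega> p \<Longrightarrow> c \<le> m \<bullet> z"
        by blast
      show ?thesis
      proof (rule finish[OF p, of "- m"])
        fix z assume "z \<in> hslice \<Omega> p"
        then have "m \<bullet> (Pr1 p + 2 *\<^sub>R v) \<le> m \<bullet> z" using m by fastforce
        then have "- m \<bullet> (z - Pr1 p) \<le> - m \<bullet> (2 *\<^sub>R v)" by (simp add: inner_diff_right inner_add_right)
        also have "\<dots> \<le> norm (- m) * norm (2 *\<^sub>R v)" by (rule norm_cauchy_schwarz)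
        finally show "- m \<bullet> (z - Pr1 p) \<le> norm (- m) * (4 * d)" using v by simp
      qed (use m in auto)
    next
      case inside: True
      \<comment> \<open>The midpoint of a horizontal segment inside the domain: since
        \<open>u\<close> is nonpositive at \<open>Q\<close>, at least half of |u p| remains.\<close>
      define \<eta> where "\<eta> = hlift p (Pr1 p + v)"
      define Q where "Q = hlift p (Pr1 p + 2 *\<^sub>R v)"
      have mid: "\<eta> = (1 - 1/2) *\<^sub>R p + (1/2) *\<^sub>R Q"
      proof -
        have "Pr1 p + v = (1 - 1/2) *\<^sub>R Pr1 p + (1/2) *\<^sub>R (Pr1 p + 2 *\<^sub>R v)"
          by (simp add: algebra_simps flip: scaleR_add_left)
        then show ?thesis unfolding \<eta>_def Q_def by (simp only: hlift_convex_comb hlift_Pr1)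
      qed
      have Q: "Q \<in> \<Omega>" using inside by (simp add: Q_def)
      have eta: "\<eta> \<in> \<Omega>" unfolding mid using cv p Q by (intro convexD) auto
      have "Q \<in> hplane p" by (simp add: Q_def hplane_eq_range)
      then have "u \<eta> \<le> (1 - 1/2) * u p + 1/2 * u Q"
        unfolding mid using p Q closure_subset[of \<Omega>] by (intro hconvex_funD[OF hc]) auto
      moreover have np: "u x \<le> 0" if "x \<in> \<Omega>" for x by (rule hconvex_nonpos[OF op hb hc zero that])
      ultimately have u: "\<bar>u p\<bar> \<le> 2 * \<bar>u \<eta>\<bar>" using np[OF p] np[OF Q] np[OF eta] by simp
      define g1 where "g1 = A + (2 * b) *\<^sub>R Jrot (Pr1 \<eta>)"
      define h1 where "h1 = A \<bullet> (Pr1 q - Pr1 \<eta>) + b * (ht q - ht \<eta>)"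
      have g1: "g1 = g0 + (2 * b) *\<^sub>R Jrot v"
        by (simp add: g1_def g0_def \<eta>_def Jrot_add scaleR_add_right)
      \<comment> \<open>The tilt has norm 4|b|d and the old normal is shorter than |b|d, which
        leaves at least 3|b|d.\<close>
      have "norm ((2 * b) *\<^sub>R Jrot v) \<le> norm g1 + norm g0"
        using norm_triangle_ineq4[of g1 g0] by (simp add: g1)
      then have g1_lower: "3 * (\<bar>b\<bar> * d) \<le> norm g1" using lt v by (simp add: abs_mult)
      have "0 \<le> norm g0" by simp
      with lt have bd: "0 < \<bar>b\<bar> * d" by linarith
      \<comment> \<open>The new base point lies in the plane at \<open>p\<close>, so the offset
        changes only through the short old normal.\<close>
      have "h1 = h0 - g0 \<bullet> v"
        unfolding h1_def h0_def g0_def \<eta>_def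
        using hsymp_self[of "Pr1 p", unfolded hsymp_eq_inner]
        by (simp add: hsymp_add_left hsymp_eq_inner inner_add_left inner_commute algebra_simps)
      moreover have "- (g0 \<bullet> v) \<le> norm g0 * (2 * d)"
        using Cauchy_Schwarz_ineq2[of g0 v] unfolding v by linarith
      moreover have "norm g0 * d \<le> (\<bar>b\<bar> * d) * d"
        using lt d by (intro mult_right_mono) auto
      moreover have "0 \<le> (\<bar>b\<bar> * d) * d"
        using d by simp
      ultimately have "h1 \<le> 3 * (\<bar>b\<bar> * d) * (4 * d)"
        using h0 by (simp only: mult.assoc mult.left_commute[of _ 2] mult.left_commute[of _ 4])
      also have "\<dots> \<le> norm g1 * (4 * d)"
        using g1_lower d by (intro mult_right_mono) auto
      finally have "h1 \<le> norm g1 * (4 * d)" .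
      moreover have "0 < norm g1" using g1_lower bd by linarith
      then have "g1 \<noteq> 0" by auto
      ultimately show ?thesis
        using slice[of _ \<eta>] unfolding g1_def[symmetric] h1_def[symmetric]
        by (intro finish[OF eta _ u, of g1]) (auto intro: order_trans)
    qed
  qed
qed

theorem theorem1p4:
  "\<exists>C>0. \<forall>(\<Omega>::'n::finite heis set) (u::'n heis \<Rightarrow> real).
     open \<Omega> \<and> horiz_bounded \<Omega> \<and> convex \<Omega> \<and>
     continuous_on (closure \<Omega>) u \<and> hconvex_fun (closure \<Omega>) u \<and>
     (\<forall>p\<in>frontier \<Omega>. u p = 0) \<longrightarrow>
     (\<forall>p0\<in>\<Omega>. ennreal (\<bar>u p0\<bar> ^ (2 * CARD('n))) \<le>
        ennreal (C * distH p0 (frontier \<Omega>) * diamHS \<Omega> ^ (2 * CARD('n) - 1))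
          * LHS_measure \<Omega> u)"
proof -
  define C where "C = 2 ^ (4 * CARD('n) + 3) / unit_ball_vol (real (2 * CARD('n)))"
  have C: "0 < C" by (simp add: C_def)
  have "ennreal (\<bar>u p\<bar> ^ (2 * CARD('n))) \<le>
      ennreal (2 * C * distH p (frontier \<Omega>) * diamHS \<Omega> ^ (2 * CARD('n) - 1)) * LHS_measure \<Omega> u"
    if *: "open \<Omega> \<and> horiz_bounded \<Omega> \<and> convex \<Omega> \<and>
      continuous_on (closure \<Omega>) u \<and> hconvex_fun (closure \<Omega>) u \<and> (\<forall>p\<in>frontier \<Omega>. u p = 0)"
      and p: "p \<in> \<Omega>" for \<Omega> :: "'n heis set" and u p
  proof -
    have R: "0 < diamHS \<Omega>" using * p diamHS_pos by blast
    define D where "D = distH p (frontier \<Omega>)"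
    obtain v :: "(real^'n) \<times> (real^'n)" where "norm v = 1"
      using vector_choose_size[of 1] zero_le_one by metis
    then have "v \<noteq> 0" by auto
    \<comment> \<open>Nonemptiness makes the infimum in \<open>distH\<close> meaningful.\<close>
    then have ne: "frontier \<Omega> \<noteq> {}" using hslice_exit[of \<Omega> p v] * p by blast
    obtain \<delta> where \<delta>: "0 < \<delta>" "\<And>q. q \<notin> \<Omega> \<Longrightarrow> \<delta> \<le> dH p q"
      using dH_compl_open_bounded_below[of \<Omega> p] * p by blast
    have "\<delta> \<le> D"
      unfolding D_def distH_def
      using ne \<delta>(2) * by (intro cINF_greatest) (auto simp: frontier_def interior_open)
    with \<delta>(1) have D: "0 < D" by simp
    have "bdd_below (dH p ` frontier \<Omega>)"
      by (rule bdd_belowI2) (rule dH_nonneg)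
    \<comment> \<open>A boundary point within twice the distance stands in for a minimiser;
      positivity of \<open>D\<close> gives the room, at the price of a factor 2 in the
      constant.\<close>
    then have "\<exists>q\<in>frontier \<Omega>. dH p q < 2 * D"
      using cINF_less_iff[OF ne, of "dH p" "2 * D"] D unfolding D_def distH_def by simp
    then obtain q where q: "q \<in> frontier \<Omega>" "dH p q \<le> 2 * D" by (auto simp: less_imp_le)
    have "ennreal (\<bar>u p\<bar> ^ (2 * CARD('n))) \<le>
        ennreal (C * dH p q * diamHS \<Omega> ^ (2 * CARD('n) - 1)) * LHS_measure \<Omega> u"
      unfolding C_def using * p q by (intro aleksandrov_frontier_point) auto
    also have "\<dots> \<le> ennreal (2 * C * D * diamHS \<Omega> ^ (2 * CARD('n) - 1)) * LHS_measure \<Omega> u"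
    proof (intro mult_right_mono ennreal_leI)
      show "C * dH p q \<le> 2 * C * D" using mult_left_mono[OF q(2), of C] C by simp
    qed (use R in auto)
    finally show ?thesis by (simp add: D_def)
  qed
  then show ?thesis using C by (intro exI[of _ "2 * C"]) auto
qed

end
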